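(* The $C^*$-algebra $C(X)'_*$ is the enveloping $C^*$-algebra of the involutive Banach algebra $C(X)'_1$; that is, $C(X)'_1$ is a dense $*$-subalgebra of $C(X)'_*$ and the enveloping $C^*$-norm of $C(X)'_1$ coincides with the restriction of the norm of $C(X)'_*$.
   Context: Let $X$ be a non-empty compact Hausdorff space and $\sigma:X\to X$ a homeomorphism. $C(X)$ is the algebra of continuous complex functions with sup norm, $\alpha(f)=f\circ\sigma^{-1}$. $\ell^1(\Sigma)$ is the set of $\ell:\mathbb{Z}\to C(X)$ with $\|\ell\|=\sum_k\|\ell(k)\|_\infty<\infty$, with product $(\ell\ell')(n)=\sum_k\ell(k)\alpha^k(\ell'(n-k))$ and involution $\ell^*(n)=\overline{\alpha^n(\ell(-n))}$; it is a unital Banach $*$-algebra containing $C(X)$ as the elements supported at $0$. $C^*(\Sigma)$ is the enveloping $C^*$-algebra of $\ell^1(\Sigma)$, which contains $\ell^1(\Sigma)$ as a dense $*$-subalgebra. $C(X)'_1$ and $C(X)'_*$ are the commutants of $C(X)$ in $\ell^1(\Sigma)$ and $C^*(\Sigma)$ respectively. *)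

theory Defs
  imports "HOL-Analysis.Analysis"
begin

text \<open>Setting: X is the (compact Hausdorff) type universe 'a, sigma a homeomorphism of it.
  Elements of l1(Sigma) are represented as functions int => 'a => complex.\<close>

type_synonym 'a seq = "int \<Rightarrow> 'a \<Rightarrow> complex"

definition spow :: "('a \<Rightarrow> 'a) \<Rightarrow> int \<Rightarrow> 'a \<Rightarrow> 'a" where
  "spow \<sigma> k = (if 0 \<le> k then \<sigma> ^^ nat k else inv \<sigma> ^^ nat (- k))"

definition alpha_pow :: "('a \<Rightarrow> 'a) \<Rightarrow> int \<Rightarrow> ('a \<Rightarrow> complex) \<Rightarrow> 'a \<Rightarrow> complex" where
  "alpha_pow \<sigma> k f = f \<circ> spow \<sigma> (- k)"

definition CX :: "('a::topological_space \<Rightarrow> complex) set" where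
  "CX = {f. continuous_on UNIV f}"

definition supn :: "('a \<Rightarrow> complex) \<Rightarrow> real" where
  "supn f = (SUP x. cmod (f x))"

definition L1 :: "('a::topological_space) seq set" where
  "L1 = {l. (\<forall>k. l k \<in> CX) \<and> (\<lambda>k. supn (l k)) summable_on UNIV}"

definition l1norm :: "'a seq \<Rightarrow> real" where
  "l1norm l = (\<Sum>\<^sub>\<infinity>k. supn (l k))"

text \<open>Product (ll')(n) = sum_k l(k) alpha^k(l'(n-k)), computed pointwise
  (the series converges absolutely in sup norm on l1(Sigma)).\<close>
definition conv :: "('a \<Rightarrow> 'a) \<Rightarrow> 'a seq \<Rightarrow> 'a seq \<Rightarrow> 'a seq" where
  "conv \<sigma> a b = (\<lambda>n x. \<Sum>\<^sub>\<infinity>k. a k x * alpha_pow \<sigma> k (b (n - k)) x)"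

definition invol :: "('a \<Rightarrow> 'a) \<Rightarrow> 'a seq \<Rightarrow> 'a seq" where
  "invol \<sigma> a = (\<lambda>n x. cnj (alpha_pow \<sigma> n (a (- n)) x))"

definition sadd :: "'a seq \<Rightarrow> 'a seq \<Rightarrow> 'a seq" where
  "sadd a b = (\<lambda>n x. a n x + b n x)"

definition ssub :: "'a seq \<Rightarrow> 'a seq \<Rightarrow> 'a seq" where
  "ssub a b = (\<lambda>n x. a n x - b n x)"

definition smul :: "complex \<Rightarrow> 'a seq \<Rightarrow> 'a seq" where
  "smul c a = (\<lambda>n x. c * a n x)"

definition delta :: "('a \<Rightarrow> complex) \<Rightarrow> 'a seq" where
  "delta f = (\<lambda>n. if n = 0 then f else (\<lambda>x. 0))"

definition comm1 :: "('a::topological_space \<Rightarrow> 'a) \<Rightarrow> 'a seq set" where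
  "comm1 \<sigma> = {a \<in> L1. \<forall>f\<in>CX. conv \<sigma> a (delta f) = conv \<sigma> (delta f) a}"

definition cstar_seminorm :: "('a \<Rightarrow> 'a) \<Rightarrow> 'a seq set \<Rightarrow> ('a seq \<Rightarrow> real) \<Rightarrow> bool" where
  "cstar_seminorm \<sigma> A p \<longleftrightarrow>
     (\<forall>a\<in>A. 0 \<le> p a) \<and>
     (\<forall>a\<in>A. \<forall>b\<in>A. p (sadd a b) \<le> p a + p b) \<and>
     (\<forall>c. \<forall>a\<in>A. p (smul c a) = cmod c * p a) \<and>
     (\<forall>a\<in>A. \<forall>b\<in>A. p (conv \<sigma> a b) \<le> p a * p b) \<and>
     (\<forall>a\<in>A. p (conv \<sigma> (invol \<sigma> a) a) = (p a)\<^sup>2)"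

text \<open>Enveloping C*-seminorm of the involutive Banach algebra A: the largest
  C*-seminorm (= sup over all *-representations).\<close>
definition env :: "('a \<Rightarrow> 'a) \<Rightarrow> 'a seq set \<Rightarrow> 'a seq \<Rightarrow> real" where
  "env \<sigma> A a = Sup {p a | p. cstar_seminorm \<sigma> A p}"

end

theory Submission
  imports Defs "HOL-Library.Function_Algebras"
begin

text \<open>A C*-seminorm on a closed unital *-subalgebra \<open>A\<close> of \<open>\<ell>\<^sup>1(\<Sigma>)\<close> is bounded by the
  \<open>\<ell>\<^sup>1\<close>-norm, because a self-adjoint element of norm less than one is a mean of two unitaries of \<open>A\<close>.
  The regular representations on the orbits show that the enveloping norm of \<open>\<ell>\<^sup>1(\<Sigma>)\<close> dominates the sup norm of every
  coefficient. Since \<open>\<int>\<close> has polynomial growth, powers of a finitely supported self-adjoint \<open>h \<in> A\<close>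
  have \<open>\<ell>\<^sup>1\<close>-norm at most a polynomial factor times the power of its enveloping norm in \<open>\<ell>\<^sup>1(\<Sigma>)\<close>,
  which gives \<open>p h \<le> env \<sigma> L1 h\<close> for every C*-seminorm \<open>p\<close> on \<open>A\<close>; hence the enveloping norms agree on
  \<open>A\<close>, in particular for \<open>A\<close> the commutant of \<open>C(X)\<close>. Density holds because the Fejer means of an element
  of the commutant in \<open>C\<^sup>*(\<Sigma>)\<close> are finitely supported elements of the commutant in \<open>\<ell>\<^sup>1(\<Sigma>)\<close>.\<close>

section \<open>The Banach *-algebra \<open>\<ell>\<^sup>1(\<Sigma>)\<close>\<close>

text \<open>The nontrivial inequality is that the enveloping norm of \<open>A\<close> is at most
  that of \<open>L1\<close>: seminorms restrict from \<open>L1\<close> to \<open>A\<close>, but an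
  abstract C*-seminorm on \<open>A\<close> comes with no extension to \<open>L1\<close>. It is
  therefore compared with \<open>env \<sigma> L1\<close> only through quantities that make sense in
  both algebras, the \<open>l1norm\<close> of powers and the sup norms of coefficients. The regular
  representations enter because a supremum over abstract seminorms is bounded below only by
  exhibiting one of them. Square roots are produced by a contraction inside \<open>A\<close>, so
  that the unitaries built from them stay in \<open>A\<close>; such roots also bound the regular
  representations. Fejer means replace sharp truncation in the density proof because cutting off
  coefficients is in general not contractive for the enveloping norm, whereas a Fejer mean of a
  finitely supported element is a convex combination of gauge translates.\<close>

lemma sadd_eq_plus: "sadd a b = a + b"
  by (simp add: sadd_def fun_eq_iff)

lemma ssub_eq_minus: "ssub a b = a - b"
  by (simp add: ssub_def fun_eq_iff)

lemma smul_apply [simp]: "smul c a n x = c * a n x"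
  by (simp add: smul_def)

abbreviation unit_seq :: "'a seq" where
  "unit_seq \<equiv> delta (\<lambda>_. 1)"

lemma infsum_single_index:
  assumes "\<And>j. j \<noteq> i \<Longrightarrow> f j = 0"
  shows "infsum f UNIV = (f i :: 'b::{comm_monoid_add,t2_space})"
  by (rule infsumI, rule has_sum_finite_neutralI[where B = "{i}"]) (use assms in auto)

lemma delta_apply: "delta f n x = (if n = 0 then f x else 0)"
  by (simp add: delta_def)

text \<open>Acting on each degree by a scalar covers scalar multiples, truncations, the gauge action
  and Fejer means at once, so one norm bound serves them all.\<close>

definition multiplier :: "(int \<Rightarrow> complex) \<Rightarrow> 'a seq \<Rightarrow> 'a seq" where
  "multiplier w a = (\<lambda>k x. w k * a k x)"

lemma multiplier_apply [simp]: "multiplier w a k x = w k * a k x"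
  by (simp add: multiplier_def)

locale compact_dynsys =
  fixes \<sigma> :: "'a::t2_space \<Rightarrow> 'a"
  assumes compact_UNIV: "compact (UNIV :: 'a set)"
    and homeo: "\<exists>g. homeomorphism UNIV UNIV \<sigma> g"
begin

section \<open>Integer powers of the homeomorphism\<close>

lemma bij_sigma: "bij \<sigma>"
  using homeo by (metis bij_betw_def homeomorphism_def inj_on_inverseI)

lemma spow_0 [simp]: "spow \<sigma> 0 x = x"
  by (simp add: spow_def)

lemma spow_Suc: "spow \<sigma> (k + 1) x = \<sigma> (spow \<sigma> k x)"
proof (cases "0 \<le> k")
  case True
  then show ?thesis
    by (simp add: spow_def nat_add_distrib)
next
  case False
  then have "nat (- k) = Suc (nat (- (k + 1)))"
    by linarith
  then show ?thesis
    using False bij_sigma by (auto simp: spow_def bij_is_surj surj_f_inv_f not_le)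
qed

lemma spow_pred: "spow \<sigma> (k - 1) x = inv \<sigma> (spow \<sigma> k x)"
  using spow_Suc[of "k - 1" x] bij_sigma by (simp add: bij_is_inj inv_f_f)

lemma spow_add: "spow \<sigma> (i + j) x = spow \<sigma> i (spow \<sigma> j x)"
proof (induction i rule: int_induct[where k = 0])
  case base
  then show ?case by simp
next
  case (step1 i)
  have "spow \<sigma> (i + 1 + j) x = \<sigma> (spow \<sigma> (i + j) x)"
    using spow_Suc[of "i + j" x] by (simp add: algebra_simps)
  then show ?case
    using step1 by (simp add: spow_Suc)
next
  case (step2 i)
  have "spow \<sigma> (i - 1 + j) x = inv \<sigma> (spow \<sigma> (i + j) x)"
    using spow_pred[of "i + j" x] by (simp add: algebra_simps)
  then show ?case
    using step2 by (simp add: spow_pred)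
qed

lemma spow_inverse [simp]: "spow \<sigma> k (spow \<sigma> (- k) x) = x" "spow \<sigma> (- k) (spow \<sigma> k x) = x"
  by (simp_all flip: spow_add)

lemma continuous_spow: "continuous_on S (spow \<sigma> k)"
proof -
  have s: "continuous_on UNIV \<sigma>" and t: "continuous_on UNIV (inv \<sigma>)"
  proof -
    obtain g where g: "homeomorphism UNIV UNIV \<sigma> g"
      using homeo by blast
    then have "inv \<sigma> = g"
      by (metis UNIV_I homeomorphism_def inv_equality)
    then show "continuous_on UNIV \<sigma>" "continuous_on UNIV (inv \<sigma>)"
      using g by (auto simp: homeomorphism_def)
  qed
  have "continuous_on UNIV (spow \<sigma> k)"
  proof (induction k rule: int_induct[where k = 0])
    case base
    then show ?case by (simp add: fun_eq_iff)
  next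
    case (step1 i)
    then show ?case
      using continuous_on_compose2[OF s] by (simp add: spow_Suc)
  next
    case (step2 i)
    then show ?case
      using continuous_on_compose2[OF t] by (simp add: spow_pred)
  qed
  then show ?thesis
    using continuous_on_subset by blast
qed

lemma conv_apply: "conv \<sigma> a b n x = (\<Sum>\<^sub>\<infinity>k. a k x * b (n - k) (spow \<sigma> (- k) x))"
  by (simp add: conv_def alpha_pow_def)

lemma invol_apply: "invol \<sigma> a n x = cnj (a (- n) (spow \<sigma> (- n) x))"
  by (simp add: invol_def alpha_pow_def)

section \<open>Sup norm and l1-norm\<close>

lemma CX_bdd: "f \<in> CX \<Longrightarrow> bdd_above (range (\<lambda>x::'a. cmod (f x)))"
  unfolding CX_def
  by (metis (mono_tags, lifting) bounded_imp_bdd_above compact_UNIV compact_continuous_image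
      compact_imp_bounded continuous_on_norm mem_Collect_eq)

lemma cmod_le_supn: "f \<in> CX \<Longrightarrow> cmod (f (x::'a)) \<le> supn f"
  unfolding supn_def by (intro cSUP_upper CX_bdd) auto

lemma supn_le: "(\<And>x::'a. cmod (f x) \<le> c) \<Longrightarrow> supn f \<le> c"
  unfolding supn_def by (intro cSUP_least) auto

lemma supn_nonneg: "f \<in> CX \<Longrightarrow> 0 \<le> supn (f::'a \<Rightarrow> complex)"
  using cmod_le_supn norm_ge_zero order_trans by blast

lemma L1_D:
  assumes "(a::'a seq) \<in> L1"
  shows "a k \<in> CX" "continuous_on UNIV (a k)" "(\<lambda>k. supn (a k)) summable_on UNIV"
    "cmod (a k x) \<le> supn (a k)" "0 \<le> supn (a k)"
  using assms cmod_le_supn supn_nonneg by (auto simp: L1_def CX_def)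

lemma l1norm_nonneg: "(a::'a seq) \<in> L1 \<Longrightarrow> 0 \<le> l1norm a"
  unfolding l1norm_def by (intro infsum_nonneg) (auto simp: L1_D)

lemma supn_le_l1norm: "(a::'a seq) \<in> L1 \<Longrightarrow> supn (a k) \<le> l1norm a"
  unfolding l1norm_def using finite_sum_le_infsum[of "\<lambda>k. supn (a k)" UNIV "{k}"]
  by (simp add: L1_D)

text \<open>A summable majorant valid at every point settles membership and the norm bound together;
  sums, multipliers, involutions and convolutions are all handled by exhibiting one.\<close>

lemma L1_dominated:
  fixes a :: "'a seq"
  assumes "\<And>k. continuous_on UNIV (a k)" "\<And>k x. cmod (a k x) \<le> M k" "M summable_on UNIV"
  shows "a \<in> L1" "l1norm a \<le> (\<Sum>\<^sub>\<infinity>k. M k)"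
proof -
  have le: "supn (a k) \<le> M k" and C: "a k \<in> CX" for k
    using assms by (auto intro: supn_le simp: CX_def)
  have "(\<lambda>k. supn (a k)) summable_on UNIV"
    by (rule summable_on_comparison_test[OF assms(3)]) (use le supn_nonneg[OF C] in auto)
  then show "a \<in> L1" "l1norm a \<le> (\<Sum>\<^sub>\<infinity>k. M k)"
    using C le assms(3) by (auto simp: L1_def l1norm_def intro: infsum_mono)
qed

lemma L1_add:
  assumes "(a::'a seq) \<in> L1" "b \<in> L1"
  shows "a + b \<in> L1" "l1norm (a + b) \<le> l1norm a + l1norm b"
proof -
  have *: "continuous_on UNIV ((a + b) k)" "cmod ((a + b) k x) \<le> supn (a k) + supn (b k)" for k x
  proof -
    have "(a + b) k = (\<lambda>x. a k x + b k x)" by (simp add: fun_eq_iff)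
    then show "continuous_on UNIV ((a + b) k)" using assms by (simp add: L1_D continuous_on_add)
    show "cmod ((a + b) k x) \<le> supn (a k) + supn (b k)"
      using L1_D(4)[OF assms(1), of k x] L1_D(4)[OF assms(2), of k x] norm_triangle_ineq[of "a k x" "b k x"]
      by simp
  qed
  show "a + b \<in> L1" "l1norm (a + b) \<le> l1norm a + l1norm b"
    using L1_dominated[of "a + b" "\<lambda>k. supn (a k) + supn (b k)", OF *] assms
      summable_on_add[of "\<lambda>k. supn (a k)" UNIV "\<lambda>k. supn (b k)"]
      infsum_add[of "\<lambda>k. supn (a k)" UNIV "\<lambda>k. supn (b k)"]
    by (simp_all add: L1_D l1norm_def del: plus_fun_apply)
qed

lemma L1_multiplier:
  assumes a: "(a::'a seq) \<in> L1" and w: "\<And>k. cmod (w k) \<le> c"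
  shows "multiplier w a \<in> L1" "l1norm (multiplier w a) \<le> c * l1norm a"
proof -
  have *: "continuous_on UNIV (multiplier w a k)" "cmod (multiplier w a k x) \<le> c * supn (a k)" for k x
  proof -
    show "continuous_on UNIV (multiplier w a k)"
      unfolding multiplier_def using a by (intro continuous_intros) (simp add: L1_D)
    show "cmod (multiplier w a k x) \<le> c * supn (a k)"
      unfolding multiplier_apply norm_mult
      using w[of k] a order_trans[OF norm_ge_zero w] by (intro mult_mono) (auto simp: L1_D)
  qed
  show "multiplier w a \<in> L1" "l1norm (multiplier w a) \<le> c * l1norm a"
    using L1_dominated[of "multiplier w a" "\<lambda>k. c * supn (a k)", OF *] a
    by (simp_all add: summable_on_cmult_right L1_D l1norm_def infsum_cmult_right')
qed

text \<open>The multiplier bound gives one inequality; the reverse is the same bound for the scalar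
  \<open>1 / c\<close> applied to \<open>smul c a\<close>.\<close>

lemma L1_smul:
  assumes "(a::'a seq) \<in> L1"
  shows "smul c a \<in> L1" "l1norm (smul c a) = cmod c * l1norm a"
proof -
  have le: "smul c a \<in> L1 \<and> l1norm (smul c a) \<le> cmod c * l1norm a" if "a \<in> L1" for a :: "'a seq" and c
    using L1_multiplier[OF that, of "\<lambda>_. c" "cmod c"] by (simp add: multiplier_def smul_def)
  then show "smul c a \<in> L1" using assms by blast
  show "l1norm (smul c a) = cmod c * l1norm a"
  proof (cases "c = 0")
    case True
    then show ?thesis using le[OF assms, of c] l1norm_nonneg by fastforce
  next
    case False
    then have "a = smul (1 / c) (smul c a)"
      by (simp add: fun_eq_iff)
    then have "l1norm a \<le> cmod (1 / c) * l1norm (smul c a)"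
      using le assms by metis
    then show ?thesis
      using le[OF assms, of c] False by (simp add: norm_divide field_simps)
  qed
qed

lemma L1_diff:
  assumes "(a::'a seq) \<in> L1" "b \<in> L1"
  shows "a - b \<in> L1" "l1norm (a - b) \<le> l1norm a + l1norm b"
proof -
  have "smul (-1) b = - b" by (simp add: fun_eq_iff)
  then show "a - b \<in> L1" "l1norm (a - b) \<le> l1norm a + l1norm b"
    using L1_add[OF assms(1) L1_smul(1)[OF assms(2)], of "-1"] L1_smul[OF assms(2), of "-1"]
    by simp_all
qed

lemma L1_finite_support:
  fixes a :: "'a seq"
  assumes "finite F" "\<And>k. k \<notin> F \<Longrightarrow> a k = (\<lambda>_. 0)" "\<And>k. a k \<in> CX"
  shows "a \<in> L1" "l1norm a = (\<Sum>k\<in>F. supn (a k))"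
proof -
  have 0: "supn (a k) = 0" if "k \<notin> F" for k
    using assms(2)[OF that] by (simp add: supn_def)
  have "((\<lambda>k. supn (a k)) has_sum (\<Sum>k\<in>F. supn (a k))) UNIV"
    by (rule has_sum_finite_neutralI) (use assms(1) 0 in auto)
  then show "a \<in> L1" "l1norm a = (\<Sum>k\<in>F. supn (a k))"
    using assms(3) infsumI by (auto simp: L1_def l1norm_def summable_on_def)
qed

lemma delta_L1:
  assumes "(f::'a \<Rightarrow> complex) \<in> CX"
  shows "delta f \<in> L1" "l1norm (delta f) = supn f"
proof -
  have "delta f k \<in> CX" for k
    using assms by (auto simp: delta_def CX_def)
  then show "delta f \<in> L1" "l1norm (delta f) = supn f"
    using L1_finite_support[of "{0}" "delta f"] by (auto simp: delta_def)
qed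

lemma unit_L1: "(unit_seq::'a seq) \<in> L1"
  by (intro delta_L1) (simp add: CX_def)

section \<open>The convolution product\<close>

lemma summable_conv_bound:
  fixes f g :: "int \<Rightarrow> real"
  assumes "f summable_on UNIV" "g summable_on UNIV" "\<And>k. 0 \<le> f k" "\<And>k. 0 \<le> g k"
  shows "(\<lambda>(n, k). f k * g (n - k)) summable_on UNIV"
    "(\<Sum>\<^sub>\<infinity>n. \<Sum>\<^sub>\<infinity>k. f k * g (n - k)) = infsum f UNIV * infsum g UNIV"
    "(\<lambda>k. f k * g (n - k)) summable_on UNIV"
    "(\<lambda>n. \<Sum>\<^sub>\<infinity>k. f k * g (n - k)) summable_on UNIV"
proof -
  \<comment> \<open>This shear turns the double series of the convolution into the product series,
    where both summability and the value of the sum can be read off.\<close>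
  have bij: "bij_betw (\<lambda>(n, k). (k, n - k)) (UNIV :: (int \<times> int) set) UNIV"
    by (rule bij_betwI[where g = "\<lambda>(k, j). (k + j, k)"]) auto
  have P: "(\<lambda>(k, j). f k * g j) summable_on UNIV \<times> UNIV"
  proof (rule summable_on_SigmaI)
    show "((\<lambda>y. case (x, y) of (k, j) \<Rightarrow> f k * g j) has_sum f x * infsum g UNIV) UNIV" for x
      using assms(2) by (simp add: has_sum_cmult_right)
    show "(\<lambda>x. f x * infsum g UNIV) summable_on UNIV"
      using assms(1) by (simp add: summable_on_cmult_left)
  qed (use assms in auto)
  then show S: "(\<lambda>(n, k). f k * g (n - k)) summable_on UNIV"
    using summable_on_reindex_bij_betw[OF bij, of "\<lambda>(k, j). f k * g j"]
    by (simp add: case_prod_unfold)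
  have "(\<Sum>\<^sub>\<infinity>n. \<Sum>\<^sub>\<infinity>k. f k * g (n - k)) = infsum (\<lambda>(n, k). f k * g (n - k)) (UNIV \<times> UNIV)"
    using infsum_Sigma'_banach[of "\<lambda>n k. f k * g (n - k)" UNIV "\<lambda>_. UNIV"] S by simp
  also have "\<dots> = infsum (\<lambda>(k, j). f k * g j) (UNIV \<times> UNIV)"
    using infsum_reindex_bij_betw[OF bij, of "\<lambda>(k, j). f k * g j"] by (simp add: case_prod_unfold)
  also have "\<dots> = (\<Sum>\<^sub>\<infinity>k. \<Sum>\<^sub>\<infinity>j. f k * g j)"
    using infsum_Sigma'_banach[of "\<lambda>k j. f k * g j" UNIV "\<lambda>_. UNIV"] P by simp
  also have "\<dots> = infsum f UNIV * infsum g UNIV"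
    by (simp add: infsum_cmult_right' infsum_cmult_left')
  finally show "(\<Sum>\<^sub>\<infinity>n. \<Sum>\<^sub>\<infinity>k. f k * g (n - k)) = infsum f UNIV * infsum g UNIV" .
  show "(\<lambda>k. f k * g (n - k)) summable_on UNIV" "(\<lambda>n. \<Sum>\<^sub>\<infinity>k. f k * g (n - k)) summable_on UNIV"
    using S summable_on_SigmaD1[of "\<lambda>n k. f k * g (n - k)" UNIV "\<lambda>_. UNIV" n] assms
      summable_on_Sigma_banach[of "\<lambda>n k. f k * g (n - k)" UNIV "\<lambda>_. UNIV"] by auto
qed

context
  fixes a b :: "'a seq"
  assumes a: "a \<in> L1" and b: "b \<in> L1"
begin

private lemma conv_term_le:
  "cmod (a k x * b (n - k) y) \<le> supn (a k) * supn (b (n - k))"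
  unfolding norm_mult using a b by (intro mult_mono) (auto simp: L1_D)

private lemmas bound = summable_conv_bound[OF L1_D(3)[OF a] L1_D(3)[OF b] L1_D(5)[OF a] L1_D(5)[OF b]]

text \<open>The evaluation point \<open>y k\<close> of \<open>b\<close> is left arbitrary because
  the twist by \<open>alpha_pow\<close> moves it with \<open>k\<close>; the sup-norm majorant is
  insensitive to it.\<close>

lemma conv_abs_summable: "(\<lambda>k. cmod (a k x * b (n - k) (y k))) summable_on UNIV"
  by (rule Infinite_Sum.abs_summable_on_comparison_test'[OF bound(3) conv_term_le])

lemma conv_summable: "(\<lambda>k. a k x * b (n - k) (y k)) summable_on UNIV"
  by (rule abs_summable_summable[OF conv_abs_summable])

text \<open>By the Weierstrass test with majorant \<open>supn (a k) * supn (b (n - k))\<close>, each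
  coefficient is a uniform limit of continuous finite sums. Summing the same majorant over
  \<open>n\<close> gives submultiplicativity.\<close>

lemma conv_L1: "conv \<sigma> a b \<in> L1" and l1norm_conv: "l1norm (conv \<sigma> a b) \<le> l1norm a * l1norm b"
proof -
  have cont: "continuous_on UNIV (conv \<sigma> a b n)" for n
  proof -
    have "uniform_limit UNIV (\<lambda>F x. \<Sum>k\<in>F. a k x * b (n - k) (spow \<sigma> (- k) x))
            (\<lambda>x. \<Sum>\<^sub>\<infinity>k. a k x * b (n - k) (spow \<sigma> (- k) x)) (finite_subsets_at_top UNIV)"
      by (rule Weierstrass_m_test_general[OF conv_term_le bound(3)])
    moreover have "continuous_on UNIV (\<lambda>x. \<Sum>k\<in>F. a k x * b (n - k) (spow \<sigma> (- k) x))" for F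
      using a b by (intro continuous_intros continuous_on_compose2[OF L1_D(2)[OF b] continuous_spow])
        (auto simp: L1_D)
    ultimately have "continuous_on UNIV (\<lambda>x. \<Sum>\<^sub>\<infinity>k. a k x * b (n - k) (spow \<sigma> (- k) x))"
      by (intro uniform_limit_theorem[where F = "finite_subsets_at_top UNIV"]) auto
    then show ?thesis
      by (simp add: conv_apply[abs_def])
  qed
  have le: "cmod (conv \<sigma> a b n x) \<le> (\<Sum>\<^sub>\<infinity>k. supn (a k) * supn (b (n - k)))" for n x
  proof -
    have "cmod (conv \<sigma> a b n x) \<le> (\<Sum>\<^sub>\<infinity>k. cmod (a k x * b (n - k) (spow \<sigma> (- k) x)))"
      unfolding conv_apply by (rule norm_infsum_bound[OF conv_abs_summable])
    also have "\<dots> \<le> (\<Sum>\<^sub>\<infinity>k. supn (a k) * supn (b (n - k)))"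
      by (intro infsum_mono conv_abs_summable bound(3) conv_term_le)
    finally show ?thesis .
  qed
  show "conv \<sigma> a b \<in> L1" "l1norm (conv \<sigma> a b) \<le> l1norm a * l1norm b"
    using L1_dominated[of "conv \<sigma> a b", OF cont le bound(4)] bound(2) by (simp_all add: l1norm_def)
qed

end

lemma conv_add_right:
  "\<lbrakk>a \<in> L1; b \<in> L1; c \<in> L1\<rbrakk> \<Longrightarrow> conv \<sigma> a (b + c) = conv \<sigma> a b + conv \<sigma> a c"
  by (intro ext) (simp add: conv_apply distrib_left, intro infsum_add conv_summable)

lemma conv_add_left:
  "\<lbrakk>a \<in> L1; b \<in> L1; c \<in> L1\<rbrakk> \<Longrightarrow> conv \<sigma> (a + b) c = conv \<sigma> a c + conv \<sigma> b c"
  by (intro ext) (simp add: conv_apply distrib_right, intro infsum_add conv_summable)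

lemma conv_diff_right:
  "\<lbrakk>a \<in> L1; b \<in> L1; c \<in> L1\<rbrakk> \<Longrightarrow> conv \<sigma> a (b - c) = conv \<sigma> a b - conv \<sigma> a c"
  using conv_add_right[of a "b - c" c] by (simp add: L1_diff)

lemma conv_diff_left:
  "\<lbrakk>a \<in> L1; b \<in> L1; c \<in> L1\<rbrakk> \<Longrightarrow> conv \<sigma> (a - b) c = conv \<sigma> a c - conv \<sigma> b c"
  using conv_add_left[of "a - b" b c] by (simp add: L1_diff)

lemma conv_smul_left: "conv \<sigma> (smul c a) b = smul c (conv \<sigma> a b)"
  by (simp add: fun_eq_iff conv_apply mult.assoc infsum_cmult_right')

lemma conv_smul_right: "conv \<sigma> a (smul c b) = smul c (conv \<sigma> a b)"
  by (simp add: fun_eq_iff conv_apply mult.left_commute infsum_cmult_right')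

lemma conv_delta_left: "conv \<sigma> (delta f) a n x = f x * a n x"
  unfolding conv_apply by (subst infsum_single_index[where i = 0]) (auto simp: delta_apply)

lemma conv_delta_right: "conv \<sigma> a (delta f) n x = a n x * f (spow \<sigma> (- n) x)"
  unfolding conv_apply by (subst infsum_single_index[where i = n]) (auto simp: delta_apply)

lemma conv_unit [simp]: "conv \<sigma> unit_seq a = a" "conv \<sigma> a unit_seq = a"
  by (simp_all add: fun_eq_iff conv_delta_left conv_delta_right)

lemma conv_assoc:
  assumes a: "a \<in> L1" and b: "b \<in> L1" and c: "c \<in> L1"
  shows "conv \<sigma> (conv \<sigma> a b) c = conv \<sigma> a (conv \<sigma> b c)"
proof (intro ext)
  fix n x
  define F where "F = (\<lambda>k m. a m x * b (k - m) (spow \<sigma> (- m) x) * c (n - k) (spow \<sigma> (- k) x))"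
  \<comment> \<open>Fubini needs joint summability; replacing the factor from \<open>c\<close> by
    the constant \<open>l1norm c\<close> leaves the two-index majorant already known from
    \<open>a\<close> and \<open>b\<close>.\<close>
  have "(\<lambda>(k, m). F k m) summable_on UNIV \<times> UNIV"
  proof (rule abs_summable_summable, rule Infinite_Sum.abs_summable_on_comparison_test')
    show "(\<lambda>p. (case p of (k, m) \<Rightarrow> supn (a m) * supn (b (k - m))) * l1norm c) summable_on UNIV \<times> UNIV"
      using summable_conv_bound(1)[OF L1_D(3)[OF a] L1_D(3)[OF b] L1_D(5)[OF a] L1_D(5)[OF b]]
      by (intro summable_on_cmult_left) simp
    have "cmod (c k y) \<le> l1norm c" for k y
      using L1_D(4)[OF c] supn_le_l1norm[OF c] order_trans by blast
    then have "cmod (F k m) \<le> supn (a m) * supn (b (k - m)) * l1norm c" for k m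
      unfolding F_def norm_mult using a b by (intro mult_mono) (auto simp: L1_D)
    then show "norm (case p of (k, m) \<Rightarrow> F k m)
        \<le> (case p of (k, m) \<Rightarrow> supn (a m) * supn (b (k - m))) * l1norm c" for p
      by (auto split: prod.split)
  qed
  then have swap: "(\<Sum>\<^sub>\<infinity>k. \<Sum>\<^sub>\<infinity>m. F k m) = (\<Sum>\<^sub>\<infinity>m. \<Sum>\<^sub>\<infinity>k. F k m)"
    by (rule infsum_swap_banach)
  have "conv \<sigma> (conv \<sigma> a b) c n x = (\<Sum>\<^sub>\<infinity>k. \<Sum>\<^sub>\<infinity>m. F k m)"
    by (simp add: conv_apply F_def infsum_cmult_left')
  also have "\<dots> = (\<Sum>\<^sub>\<infinity>m. \<Sum>\<^sub>\<infinity>l. F (m + l) m)"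
  proof -
    have "(\<Sum>\<^sub>\<infinity>k. F k m) = (\<Sum>\<^sub>\<infinity>l. F (m + l) m)" for m
      by (rule infsum_reindex_bij_witness[where i = "\<lambda>l. m + l" and j = "\<lambda>k. k - m"]) auto
    then show ?thesis
      by (simp add: swap)
  qed
  also have "\<dots> = conv \<sigma> a (conv \<sigma> b c) n x"
    by (simp add: conv_apply F_def infsum_cmult_right' mult.assoc add.commute algebra_simps flip: spow_add)
  finally show "conv \<sigma> (conv \<sigma> a b) c n x = conv \<sigma> a (conv \<sigma> b c) n x" .
qed

section \<open>The involution\<close>

lemma invol_invol [simp]: "invol \<sigma> (invol \<sigma> a) = a"
  by (simp add: fun_eq_iff invol_apply flip: spow_add)

lemma invol_add: "invol \<sigma> (a + b) = invol \<sigma> a + invol \<sigma> b"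
  by (simp add: fun_eq_iff invol_apply)

lemma invol_diff: "invol \<sigma> (a - b) = invol \<sigma> a - invol \<sigma> b"
  by (simp add: fun_eq_iff invol_apply)

lemma invol_smul: "invol \<sigma> (smul c a) = smul (cnj c) (invol \<sigma> a)"
  by (simp add: fun_eq_iff invol_apply)

lemma invol_unit [simp]: "invol \<sigma> unit_seq = unit_seq"
  by (simp add: fun_eq_iff invol_apply delta_apply)

lemma invol_conv: "invol \<sigma> (conv \<sigma> a b) = conv \<sigma> (invol \<sigma> b) (invol \<sigma> a)"
proof (intro ext)
  fix n x
  have "invol \<sigma> (conv \<sigma> a b) n x =
      (\<Sum>\<^sub>\<infinity>k. cnj (a k (spow \<sigma> (- n) x) * b (- n - k) (spow \<sigma> (- k) (spow \<sigma> (- n) x))))"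
    by (simp only: invol_apply conv_apply flip: infsum_cnj)
  also have "\<dots> = conv \<sigma> (invol \<sigma> b) (invol \<sigma> a) n x"
    unfolding conv_apply invol_apply
    by (rule infsum_reindex_bij_witness[where i = "\<lambda>j. j - n" and j = "\<lambda>k. k + n"])
      (auto simp: algebra_simps minus_diff_commute simp flip: spow_add)
  finally show "invol \<sigma> (conv \<sigma> a b) n x = conv \<sigma> (invol \<sigma> b) (invol \<sigma> a) n x" .
qed

lemma invol_L1:
  assumes "a \<in> L1"
  shows "invol \<sigma> a \<in> L1" "l1norm (invol \<sigma> a) = l1norm a"
proof -
  have le: "invol \<sigma> a \<in> L1 \<and> l1norm (invol \<sigma> a) \<le> l1norm a" if "a \<in> L1" for a
  proof -
    have bij: "bij_betw uminus (UNIV :: int set) UNIV"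
      by (rule bij_betwI[where g = uminus]) auto
    have "continuous_on UNIV (invol \<sigma> a k)" for k
      unfolding invol_apply[abs_def]
      by (intro continuous_intros continuous_on_compose2[OF L1_D(2)[OF that] continuous_spow]) auto
    moreover have "cmod (invol \<sigma> a k x) \<le> supn (a (- k))" for k x
      using that by (simp add: invol_apply L1_D)
    ultimately show ?thesis
      using L1_dominated[of "invol \<sigma> a" "\<lambda>k. supn (a (- k))"] L1_D(3)[OF that]
        summable_on_reindex_bij_betw[OF bij, of "\<lambda>k. supn (a k)"]
        infsum_reindex_bij_betw[OF bij, of "\<lambda>k. supn (a k)"]
      by (simp add: l1norm_def)
  qed
  show L: "invol \<sigma> a \<in> L1"
    using le[OF assms] ..
  show "l1norm (invol \<sigma> a) = l1norm a"
    using le[OF assms] le[OF L] by (intro antisym) auto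
qed

section \<open>Limits and completeness\<close>

lemma L1_limit_apply:
  fixes l :: "'a seq"
  assumes "\<And>n. s n \<in> L1" "l \<in> L1" "(\<lambda>n::nat. l1norm (s n - l)) \<longlonglongrightarrow> 0"
  shows "(\<lambda>n. s n k x) \<longlonglongrightarrow> l k x"
proof (rule LIM_zero_cancel, rule Lim_null_comparison[OF _ assms(3)], rule always_eventually, rule allI)
  fix n
  have "s n - l \<in> L1" using assms L1_diff by blast
  then show "norm (s n k x - l k x) \<le> l1norm (s n - l)"
    using L1_D(4)[of "s n - l" k x] supn_le_l1norm[of "s n - l" k] by simp
qed

text \<open>Sup norms do not pass to pointwise limits directly. Finite sums are first estimated with
  each degree \<open>k\<close> evaluated at its own point \<open>y k\<close>, where only finitely
  many numbers converge; near-maximal points then recover the sup norms.\<close>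

lemma L1_complete:
  fixes s :: "nat \<Rightarrow> 'a seq"
  assumes s: "\<And>n. s n \<in> L1"
    and Cauchy: "\<And>e. 0 < e \<Longrightarrow> \<exists>N. \<forall>m\<ge>N. \<forall>n\<ge>N. l1norm (s m - s n) < e"
  obtains l where "l \<in> L1" "(\<lambda>n. l1norm (s n - l)) \<longlonglongrightarrow> 0"
proof -
  have d: "s m - s n \<in> L1" for m n
    using s L1_diff by blast
  have le: "cmod (s m k x - s n k x) \<le> supn ((s m - s n) k)" for m n k x
    using L1_D(4)[OF d, of m n k x] by simp
  have "convergent (\<lambda>n. s n k x)" for k x
  proof (rule Cauchy_convergent, rule metric_CauchyI)
    fix e :: real assume "0 < e"
    then obtain N where N: "\<forall>m\<ge>N. \<forall>n\<ge>N. l1norm (s m - s n) < e"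
      using Cauchy by blast
    then show "\<exists>M. \<forall>m\<ge>M. \<forall>n\<ge>M. dist (s m k x) (s n k x) < e"
      using le supn_le_l1norm[OF d] by (metis dist_norm order_le_less_trans)
  qed
  then obtain l where l: "\<And>k x. (\<lambda>n. s n k x) \<longlonglongrightarrow> l k x"
    unfolding convergent_def by metis
  have fin: "\<exists>N. \<forall>n\<ge>N. \<forall>F. finite F \<longrightarrow> (\<Sum>k\<in>F. supn (s n k - l k)) \<le> e
      \<and> (\<forall>k x. cmod (s n k x - l k x) \<le> e)" if "0 < e" for e
  proof -
    obtain N where N: "\<forall>m\<ge>N. \<forall>n\<ge>N. l1norm (s m - s n) < e"
      using Cauchy[OF \<open>0 < e\<close>] by blast
    {
      fix n and F :: "int set" and y :: "int \<Rightarrow> 'a" assume n: "N \<le> n" and F: "finite F"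
      have "(\<Sum>k\<in>F. cmod (s n k (y k) - s m k (y k))) \<le> e" if "N \<le> m" for m
      proof -
        have "(\<Sum>k\<in>F. cmod (s n k (y k) - s m k (y k))) \<le> (\<Sum>k\<in>F. supn ((s n - s m) k))"
          by (intro sum_mono le)
        also have "\<dots> \<le> l1norm (s n - s m)"
          unfolding l1norm_def using F L1_D[OF d] by (intro finite_sum_le_infsum) auto
        also have "\<dots> \<le> e"
          using N n that by (meson less_imp_le)
        finally show ?thesis .
      qed
      then have "(\<Sum>k\<in>F. cmod (s n k (y k) - l k (y k))) \<le> e"
        by (intro tendsto_upperbound[of "\<lambda>m. \<Sum>k\<in>F. cmod (s n k (y k) - s m k (y k))" _ sequentially]
            tendsto_intros l) (auto simp: eventually_sequentially)
    } note pt = this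
    have one: "cmod (s n k x - l k x) \<le> e" if "N \<le> n" for n k x
      using pt[OF that, of "{k}" "\<lambda>_. x"] by simp
    have "(\<Sum>k\<in>F. supn (s n k - l k)) \<le> e" if n: "N \<le> n" and F: "finite F" for n F
    proof (rule field_le_epsilon)
      fix r :: real assume r: "0 < r"
      \<comment> \<open>The slack is spent once per element of \<open>F\<close>, hence the division
        by its cardinality; the added 1 covers the empty set.\<close>
      define r' where "r' = r / (real (card F) + 1)"
      have r': "0 < r'" using r by (simp add: r'_def)
      have "\<exists>x. supn (s n k - l k) - r' < cmod (s n k x - l k x)" for k
      proof -
        have "supn (s n k - l k) - r' < (SUP x. cmod ((s n k - l k) x))"
          using r' by (simp add: supn_def)
        then show ?thesis
          by (subst (asm) less_cSUP_iff) (auto intro!: bdd_aboveI[where M = e] one[OF n])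
      qed
      then obtain y where y: "\<And>k. supn (s n k - l k) - r' < cmod (s n k (y k) - l k (y k))"
        by metis
      have "(\<Sum>k\<in>F. supn (s n k - l k)) \<le> (\<Sum>k\<in>F. cmod (s n k (y k) - l k (y k)) + r')"
        using y by (intro sum_mono) (simp add: less_imp_le diff_le_eq flip: diff_less_eq)
      also have "\<dots> \<le> e + card F * r'"
        using pt[OF n F] by (simp add: sum.distrib)
      also have "card F * r' \<le> r"
        using r by (simp add: r'_def field_simps)
      finally show "(\<Sum>k\<in>F. supn (s n k - l k)) \<le> e + r" by simp
    qed
    then show ?thesis
      using one by blast
  qed
  have cont: "continuous_on UNIV (l k)" for k
  proof (rule uniform_limit_theorem)
    show "\<forall>\<^sub>F n in sequentially. continuous_on UNIV (s n k)"
      using s by (simp add: L1_D)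
    show "uniform_limit UNIV (\<lambda>n. s n k) (l k) sequentially"
    proof (rule uniform_limitI)
      fix e :: real assume "0 < e"
      then obtain N where "\<forall>n\<ge>N. \<forall>k x. cmod (s n k x - l k x) \<le> e / 2"
        using fin[of "e / 2"] by (metis finite.emptyI half_gt_zero)
      then have "\<forall>n\<ge>N. \<forall>x. dist (s n k x) (l k x) < e"
        using \<open>0 < e\<close> by (fastforce simp: dist_norm intro: order_le_less_trans[of _ "e / 2"])
      then show "\<forall>\<^sub>F n in sequentially. \<forall>x\<in>UNIV. dist (s n k x) (l k x) < e"
        unfolding eventually_sequentially by blast
    qed
  qed auto
  have C: "s n k - l k \<in> CX" for n k
    using cont[of k] L1_D(2)[OF s[of n], of k] continuous_on_diff
    unfolding CX_def by (fastforce simp: fun_diff_def)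
  have summ: "\<exists>N. \<forall>n\<ge>N. s n - l \<in> L1 \<and> l1norm (s n - l) \<le> e" if "0 < e" for e
  proof -
    obtain N where N: "\<And>n F. N \<le> n \<Longrightarrow> finite F \<Longrightarrow> (\<Sum>k\<in>F. supn (s n k - l k)) \<le> e"
      using fin[OF \<open>0 < e\<close>] by blast
    have "s n - l \<in> L1 \<and> l1norm (s n - l) \<le> e" if n: "N \<le> n" for n
    proof -
      have "(\<lambda>k. supn (s n k - l k)) summable_on UNIV"
        using N[OF n] supn_nonneg[OF C] by (intro nonneg_bdd_above_summable_on bdd_aboveI2) auto
      then show ?thesis
        using N[OF n] C by (auto simp: L1_def l1norm_def intro!: infsum_le_finite_sums)
    qed
    then show ?thesis by blast
  qed
  obtain N where "s N - l \<in> L1"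
    using summ[of 1] by auto
  then have "l \<in> L1"
    using L1_diff(1)[OF s[of N], of "s N - l"] by simp
  moreover have "(\<lambda>n. l1norm (s n - l)) \<longlonglongrightarrow> 0"
  proof (rule LIMSEQ_I)
    fix e :: real assume "0 < e"
    then show "\<exists>N. \<forall>n\<ge>N. norm (l1norm (s n - l) - 0) < e"
      using summ[of "e / 2"] l1norm_nonneg by fastforce
  qed
  ultimately show thesis
    using that by blast
qed

end

section \<open>Square roots and contractivity of C*-seminorms\<close>

context compact_dynsys
begin

lemma l1norm_eq_0D:
  assumes "(a::'a seq) \<in> L1" "l1norm a = 0"
  shows "a = 0"
proof -
  have "cmod (a k x) \<le> 0" for k x
    using L1_D(4)[OF assms(1)] supn_le_l1norm[OF assms(1)] assms(2) order_trans by metis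
  then show ?thesis
    by (simp add: fun_eq_iff)
qed

lemma l1norm_minus_commute: "l1norm (a - b) = l1norm (b - (a::'a seq))"
  by (simp add: l1norm_def supn_def norm_minus_commute)

text \<open>Since \<open>g\<close> commutes with \<open>s n\<close>, its commutator with
  \<open>l\<close> is, up to sign, the one with \<open>s n - l\<close>, whose norm is at most twice
  the product of the norms.\<close>

lemma conv_commute_limit:
  fixes l :: "'a seq"
  assumes s: "\<And>n::nat. s n \<in> L1" and l: "l \<in> L1" "(\<lambda>n. l1norm (s n - l)) \<longlonglongrightarrow> 0"
    and g: "g \<in> L1" and comm: "\<And>n. conv \<sigma> g (s n) = conv \<sigma> (s n) g"
  shows "conv \<sigma> g l = conv \<sigma> l g"
proof -
  have L: "conv \<sigma> g l - conv \<sigma> l g \<in> L1"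
    using g l by (intro L1_diff conv_L1)
  have "l1norm (conv \<sigma> g l - conv \<sigma> l g) \<le> 2 * (l1norm g * l1norm (s n - l))" for n
  proof -
    have d: "s n - l \<in> L1" using s l L1_diff by blast
    have eq: "conv \<sigma> g l - conv \<sigma> l g = conv \<sigma> (s n - l) g - conv \<sigma> g (s n - l)"
      using s l g comm[of n] by (simp add: conv_diff_left conv_diff_right)
    show ?thesis
      unfolding eq using L1_diff(2)[OF conv_L1[OF d g] conv_L1[OF g d]] l1norm_conv[OF d g] l1norm_conv[OF g d]
      by (simp add: mult.commute)
  qed
  moreover have "(\<lambda>n. 2 * (l1norm g * l1norm (s n - l))) \<longlonglongrightarrow> 2 * (l1norm g * 0)"
    by (intro tendsto_intros l)
  ultimately have "l1norm (conv \<sigma> g l - conv \<sigma> l g) \<le> 2 * (l1norm g * 0)"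
    by (intro tendsto_lowerbound[of "\<lambda>n. 2 * (l1norm g * l1norm (s n - l))" _ sequentially]) auto
  then have "conv \<sigma> g l - conv \<sigma> l g = 0"
    using l1norm_eq_0D[OF L] l1norm_nonneg[OF L] by simp
  then show ?thesis by simp
qed

end

text \<open>\<open>limit_mem\<close> keeps square roots inside \<open>A\<close>, and
  \<open>multiplier_mem\<close> keeps truncations inside \<open>A\<close>. The locale is
  instantiated both with \<open>L1\<close> and with the commutant, so that estimates in the two can
  be compared.\<close>

locale l1_subalgebra = compact_dynsys \<sigma> for \<sigma> :: "'a::t2_space \<Rightarrow> 'a" +
  fixes A :: "'a seq set"
  assumes subset_L1: "A \<subseteq> L1"
    and unit_mem: "unit_seq \<in> A"
    and add_mem: "a \<in> A \<Longrightarrow> b \<in> A \<Longrightarrow> a + b \<in> A"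
    and smul_mem: "a \<in> A \<Longrightarrow> smul c a \<in> A"
    and conv_mem: "a \<in> A \<Longrightarrow> b \<in> A \<Longrightarrow> conv \<sigma> a b \<in> A"
    and invol_mem: "a \<in> A \<Longrightarrow> invol \<sigma> a \<in> A"
    and multiplier_mem: "a \<in> A \<Longrightarrow> (\<And>k. cmod (w k) \<le> 1) \<Longrightarrow> multiplier w a \<in> A"
    and limit_mem: "\<lbrakk>\<And>n::nat. s n \<in> A; l \<in> L1; (\<lambda>n. l1norm (s n - l)) \<longlonglongrightarrow> 0\<rbrakk> \<Longrightarrow> l \<in> A"
begin

lemma mem_L1: "a \<in> A \<Longrightarrow> a \<in> L1"
  using subset_L1 by blast

lemma diff_mem:
  assumes "a \<in> A" "b \<in> A"
  shows "a - b \<in> A"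
proof -
  have "smul (-1) b = - b" by (simp add: fun_eq_iff)
  then show ?thesis using add_mem[OF assms(1) smul_mem[OF assms(2), of "-1"]] by simp
qed

text \<open>The square root \<open>1 - w\<close> of \<open>1 - h\<close> is found by contraction: \<open>(1 - w)\<^sup>2 = 1 - h\<close> says that
  \<open>w\<close> is a fixed point of \<open>w \<mapsto> (h + w\<^sup>2) / 2\<close>, which preserves the ball whose radius \<open>\<rho>\<close> solves the
  scalar equation \<open>\<rho> = (\<parallel>h\<parallel> + \<rho>\<^sup>2) / 2\<close>.\<close>
lemma sqrt_one_minus:
  assumes h: "h \<in> A" "invol \<sigma> h = h" "l1norm h < 1"
  obtains u where "u \<in> A" "invol \<sigma> u = u" "conv \<sigma> u u = unit_seq - h"
    "\<And>g. \<lbrakk>g \<in> L1; conv \<sigma> g h = conv \<sigma> h g\<rbrakk> \<Longrightarrow> conv \<sigma> g u = conv \<sigma> u g"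
proof -
  \<comment> \<open>The smaller root of the quadratic lies below 1, which lets the radius double as
    the contraction constant of \<open>T\<close>.\<close>
  define \<rho> where "\<rho> = 1 - sqrt (1 - l1norm h)"
  have h0: "0 \<le> l1norm h" and hL: "h \<in> L1"
    using h mem_L1 l1norm_nonneg by auto
  have \<rho>: "0 \<le> \<rho>" "\<rho> < 1" "l1norm h + \<rho> * \<rho> = 2 * \<rho>"
    using h h0 by (auto simp: \<rho>_def algebra_simps)
  \<comment> \<open>Carrying the commutation clause in the complete set makes it hold for the fixed
    point, without an expansion of that point in powers of \<open>h\<close>.\<close>
  define S where "S = {w \<in> A. invol \<sigma> w = w \<and> l1norm w \<le> \<rho> \<and>
    (\<forall>g\<in>L1. conv \<sigma> g h = conv \<sigma> h g \<longrightarrow> conv \<sigma> g w = conv \<sigma> w g)}"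
  have SA: "w \<in> A" and SL: "w \<in> L1" and Sn: "l1norm w \<le> \<rho>" if "w \<in> S" for w
    using that mem_L1 by (auto simp: S_def)
  define T where "T = (\<lambda>w. smul (1 / 2) (h + conv \<sigma> w w))"
  \<comment> \<open>\<open>Metric_space\<close> asks for nonnegativity also outside the carrier,
    where \<open>l1norm\<close> is not controlled; on \<open>S\<close> the absolute value changes
    nothing.\<close>
  define d where "d = (\<lambda>x y::'a seq. \<bar>l1norm (x - y)\<bar>)"
  have d_eq: "d x y = l1norm (x - y)" if "x \<in> L1" "y \<in> L1" for x y
    using that L1_diff l1norm_nonneg by (simp add: d_def)
  interpret Metric_space S d
  proof
    fix x y z :: "'a seq"
    show "0 \<le> d x y" "d x y = d y x"
      using l1norm_minus_commute by (auto simp: d_def)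
    show "d x y = 0 \<longleftrightarrow> x = y" if "x \<in> S" "y \<in> S"
    proof
      assume "d x y = 0"
      then show "x = y"
        using that SL l1norm_eq_0D[of "x - y"] L1_diff by (simp add: d_eq)
    next
      assume "x = y"
      then have "d x y = \<bar>l1norm (0::'a seq)\<bar>" by (simp add: d_def)
      then show "d x y = 0"
        by (simp add: l1norm_def supn_def)
    qed
    show "d x z \<le> d x y + d y z" if "x \<in> S" "y \<in> S" "z \<in> S"
      using that SL L1_add(2)[of "x - y" "y - z"] L1_diff by (simp add: d_eq)
  qed
  have complete: mcomplete
    unfolding mcomplete_def
  proof (intro allI impI)
    fix s :: "nat \<Rightarrow> 'a seq"
    assume "MCauchy s"
    then have sS: "s n \<in> S" for n
      by (auto simp: MCauchy_def)
    note sL = SL[OF sS]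
    have "\<exists>N. \<forall>m\<ge>N. \<forall>n\<ge>N. l1norm (s m - s n) < e" if "0 < e" for e
      using \<open>MCauchy s\<close> that by (simp add: MCauchy_def d_eq sL)
    then obtain l where l: "l \<in> L1" "(\<lambda>n. l1norm (s n - l)) \<longlonglongrightarrow> 0"
      using L1_complete[of s, OF sL] by blast
    have "l1norm l \<le> \<rho>"
    proof (rule tendsto_lowerbound[of "\<lambda>n. \<rho> + l1norm (s n - l)" _ sequentially])
      show "(\<lambda>n. \<rho> + l1norm (s n - l)) \<longlonglongrightarrow> \<rho>"
        using tendsto_add[OF tendsto_const l(2)] by simp
      have "l1norm l \<le> \<rho> + l1norm (s n - l)" for n
        using L1_diff[OF sL[of n] L1_diff(1)[OF sL[of n] l(1)]] Sn[OF sS[of n]] by simp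
      then show "\<forall>\<^sub>F n in sequentially. l1norm l \<le> \<rho> + l1norm (s n - l)" by simp
    qed simp
    moreover have "invol \<sigma> l k x = l k x" for k x
    proof (rule LIMSEQ_unique)
      show "(\<lambda>n. s n k x) \<longlonglongrightarrow> l k x"
        by (rule L1_limit_apply[OF sL l])
      have "(\<lambda>n. invol \<sigma> (s n) k x) \<longlonglongrightarrow> invol \<sigma> l k x"
        unfolding invol_apply by (intro tendsto_intros L1_limit_apply[OF sL l])
      then show "(\<lambda>n. s n k x) \<longlonglongrightarrow> invol \<sigma> l k x"
        using sS by (simp add: S_def)
    qed
    moreover have "conv \<sigma> g l = conv \<sigma> l g" if "g \<in> L1" "conv \<sigma> g h = conv \<sigma> h g" for g
      by (rule conv_commute_limit[OF sL l that(1)]) (use sS that in \<open>auto simp: S_def\<close>)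
    ultimately have lS: "l \<in> S"
      using limit_mem[OF SA[OF sS] l] by (auto simp: S_def fun_eq_iff)
    then have "limitin mtopology s l sequentially"
      unfolding limit_metric_sequentially
      using sS l(2) sL l(1) by (simp add: LIMSEQ_iff d_eq abs_less_iff) blast
    then show "\<exists>l. limitin mtopology s l sequentially" by blast
  qed
  have "0 \<in> S"
  proof -
    have "(0::'a seq) = smul 0 unit_seq" by (simp add: fun_eq_iff)
    then have "(0::'a seq) \<in> A" using smul_mem unit_mem by metis
    moreover have "invol \<sigma> 0 = 0" "conv \<sigma> g 0 = 0" "conv \<sigma> 0 g = 0" for g
      by (simp_all add: fun_eq_iff invol_apply conv_apply)
    moreover have "l1norm (0::'a seq) = 0"
      by (simp add: l1norm_def supn_def)
    ultimately show ?thesis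
      using \<rho> by (simp add: S_def)
  qed
  moreover have "T \<in> S \<rightarrow> S"
  proof
    fix w assume w: "w \<in> S"
    note wL = SL[OF w]
    have ww: "conv \<sigma> w w \<in> L1"
      using wL conv_L1 by blast
    have "l1norm (T w) \<le> (l1norm h + l1norm w * l1norm w) / 2"
      unfolding T_def L1_smul(2)[OF L1_add(1)[OF hL ww]]
      using L1_add(2)[OF hL ww] l1norm_conv[OF wL wL] by simp
    also have "\<dots> \<le> (l1norm h + \<rho> * \<rho>) / 2"
      using mult_mono[OF Sn[OF w] Sn[OF w] \<rho>(1) l1norm_nonneg[OF wL]] by simp
    finally have "l1norm (T w) \<le> \<rho>"
      using \<rho>(3) by simp
    moreover have "invol \<sigma> (T w) = T w"
      using w h by (simp add: T_def S_def invol_smul invol_add invol_conv)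
    moreover have "conv \<sigma> g (T w) = conv \<sigma> (T w) g" if g: "g \<in> L1" "conv \<sigma> g h = conv \<sigma> h g" for g
    proof -
      have gw: "conv \<sigma> g w = conv \<sigma> w g"
        using w g by (simp add: S_def)
      then have "conv \<sigma> g (conv \<sigma> w w) = conv \<sigma> (conv \<sigma> w w) g"
        using g wL by (metis conv_assoc)
      then show ?thesis
        using g wL hL ww by (simp add: T_def conv_smul_left conv_smul_right conv_add_left conv_add_right)
    qed
    moreover have "T w \<in> A"
      unfolding T_def using SA[OF w] h by (intro smul_mem add_mem conv_mem)
    ultimately show "T w \<in> S"
      by (simp add: S_def)
  qed
  moreover have "d (T w) (T v) \<le> \<rho> * d w v" if w: "w \<in> S" and v: "v \<in> S" for w v
  proof -
    note wL = SL[OF w] and vL = SL[OF v]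
    have dL: "w - v \<in> L1" using wL vL L1_diff by blast
    have T: "T w \<in> L1" "T v \<in> L1"
      using SL that \<open>T \<in> S \<rightarrow> S\<close> by auto
    have eq: "conv \<sigma> w w - conv \<sigma> v v = conv \<sigma> w (w - v) + conv \<sigma> (w - v) v"
      using wL vL by (simp add: conv_diff_left conv_diff_right)
    have "T w - T v = smul (1 / 2) (conv \<sigma> w w - conv \<sigma> v v)"
      by (simp add: T_def fun_eq_iff algebra_simps)
    then have "d (T w) (T v) = l1norm (smul (1 / 2) (conv \<sigma> w w - conv \<sigma> v v))"
      using T by (simp only: d_eq)
    also have "\<dots> = l1norm (conv \<sigma> w (w - v) + conv \<sigma> (w - v) v) / 2"
      unfolding eq L1_smul(2)[OF L1_add(1)[OF conv_L1[OF wL dL] conv_L1[OF dL vL]]] by simp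
    also have "\<dots> \<le> (l1norm w * l1norm (w - v) + l1norm (w - v) * l1norm v) / 2"
      using L1_add(2)[OF conv_L1[OF wL dL] conv_L1[OF dL vL]] l1norm_conv[OF wL dL] l1norm_conv[OF dL vL]
      by simp
    also have "\<dots> \<le> (\<rho> * l1norm (w - v) + l1norm (w - v) * \<rho>) / 2"
      using Sn[OF w] Sn[OF v] l1norm_nonneg[OF dL]
      by (intro divide_right_mono add_mono mult_right_mono mult_left_mono) auto
    finally show ?thesis
      using wL vL by (simp add: d_eq)
  qed
  ultimately obtain w where w: "w \<in> S" "T w = w"
    using Banach_fixedpoint_thm[OF complete _ _ \<rho>(2)] by blast
  note wL = SL[OF w(1)]
  have "conv \<sigma> w w n x = 2 * w n x - h n x" for n x
    using arg_cong[OF w(2), of "\<lambda>w. w n x"] by (simp add: T_def field_simps)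
  then have ww: "conv \<sigma> w w = w + w - h"
    by (simp add: fun_eq_iff)
  have "conv \<sigma> (unit_seq - w) (unit_seq - w) = unit_seq - h"
    using unit_L1 wL ww by (simp add: conv_diff_left conv_diff_right L1_diff)
  moreover have "conv \<sigma> g (unit_seq - w) = conv \<sigma> (unit_seq - w) g" if "g \<in> L1" "conv \<sigma> g h = conv \<sigma> h g" for g
    using that w unit_L1 wL by (simp add: S_def conv_diff_left conv_diff_right)
  moreover have "unit_seq - w \<in> A"
    using diff_mem unit_mem SA w by blast
  moreover have "invol \<sigma> (unit_seq - w) = unit_seq - w"
    using w by (simp add: S_def invol_diff)
  ultimately show thesis
    using that by blast
qed

context
  fixes p
  assumes p: "cstar_seminorm \<sigma> A p"
begin

lemma cstar_nonneg: "a \<in> A \<Longrightarrow> 0 \<le> p a"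
  and cstar_add: "a \<in> A \<Longrightarrow> b \<in> A \<Longrightarrow> p (a + b) \<le> p a + p b"
  and cstar_smul: "a \<in> A \<Longrightarrow> p (smul c a) = cmod c * p a"
  and cstar_conv: "a \<in> A \<Longrightarrow> b \<in> A \<Longrightarrow> p (conv \<sigma> a b) \<le> p a * p b"
  and cstar_square: "a \<in> A \<Longrightarrow> p (conv \<sigma> (invol \<sigma> a) a) = (p a)\<^sup>2"
  using p by (auto simp: cstar_seminorm_def sadd_eq_plus)

lemma cstar_diff:
  assumes "a \<in> A" "b \<in> A"
  shows "p (a - b) \<le> p a + p b"
proof -
  have "smul (-1) b = - b" by (simp add: fun_eq_iff)
  then show ?thesis
    using cstar_add[OF assms(1) smul_mem[OF assms(2), of "-1"]] cstar_smul[OF assms(2), of "-1"] by simp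
qed

text \<open>The C*-identity makes \<open>p unit_seq\<close> equal to its own square; the value 0
  occurs for the zero seminorm, so only an upper bound can be claimed.\<close>

lemma cstar_unit_le_1: "p unit_seq \<le> 1"
proof -
  have "p unit_seq = (p unit_seq)\<^sup>2"
    using cstar_square[OF unit_mem] by simp
  then have "p unit_seq = 0 \<or> p unit_seq = 1"
    by (simp add: power2_eq_square)
  then show ?thesis by auto
qed

lemma cstar_unitary_le_1:
  assumes "v \<in> A" "conv \<sigma> (invol \<sigma> v) v = unit_seq"
  shows "p v \<le> 1"
proof -
  have "(p v)\<^sup>2 \<le> 1"
    using cstar_square[OF assms(1)] assms(2) cstar_unit_le_1 by simp
  then show ?thesis
    using cstar_nonneg[OF assms(1)] by (simp add: power_le_one_iff)
qed

text \<open>A self-adjoint \<open>h\<close> with \<open>\<parallel>h\<parallel> < 1\<close> is the mean of the unitaries \<open>h \<plusminus> i \<surd>(1 - h\<^sup>2)\<close>.\<close>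
lemma cstar_selfadjoint_le_1:
  assumes h: "h \<in> A" "invol \<sigma> h = h" "l1norm h < 1"
  shows "p h \<le> 1"
proof -
  have hL: "h \<in> L1" using h mem_L1 by blast
  have "l1norm (conv \<sigma> h h) \<le> l1norm h * l1norm h"
    using l1norm_conv[OF hL hL] .
  also have "\<dots> < 1"
    using h l1norm_nonneg[OF hL] mult_strict_mono'[of "l1norm h" 1 "l1norm h" 1] by simp
  finally have "l1norm (conv \<sigma> h h) < 1" .
  moreover have "invol \<sigma> (conv \<sigma> h h) = conv \<sigma> h h"
    using h by (simp add: invol_conv)
  ultimately obtain u where u: "u \<in> A" "invol \<sigma> u = u" "conv \<sigma> u u = unit_seq - conv \<sigma> h h"
    "\<And>g. \<lbrakk>g \<in> L1; conv \<sigma> g (conv \<sigma> h h) = conv \<sigma> (conv \<sigma> h h) g\<rbrakk> \<Longrightarrow> conv \<sigma> g u = conv \<sigma> u g"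
    using sqrt_one_minus[OF conv_mem[OF h(1) h(1)]] by blast
  have uL: "u \<in> L1" using u mem_L1 by blast
  \<comment> \<open>\<open>h\<close> commutes with its square, hence with the root \<open>u\<close>;
    this cancels the cross terms in the product below.\<close>
  have hu: "conv \<sigma> h u = conv \<sigma> u h"
    using u(4)[OF hL] conv_assoc[OF hL hL hL] by simp
  define v where "v c = h + smul c u" for c
  have vA: "v c \<in> A" for c
    unfolding v_def by (intro add_mem smul_mem h u)
  have vstar: "invol \<sigma> (v c) = v (cnj c)" for c
    using h u by (simp add: v_def invol_add invol_smul)
  \<comment> \<open>For \<open>c\<close> equal to \<open>\<i>\<close> or \<open>- \<i>\<close>,
    \<open>- c\<close> is \<open>cnj c\<close>, so by \<open>vstar\<close> this is the unitarity
    relation for \<open>v c\<close>.\<close>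
  have "conv \<sigma> (v (- c)) (v c) = unit_seq" if "c * c = - 1" for c
  proof -
    have "conv \<sigma> (v (- c)) (v c) = conv \<sigma> h (v c) + smul (- c) (conv \<sigma> u (v c))"
      unfolding v_def[of "- c"] using hL uL mem_L1[OF vA]
      by (simp add: conv_add_left conv_smul_left L1_smul)
    also have "\<dots> = (conv \<sigma> h h + smul c (conv \<sigma> h u)) + smul (- c) (conv \<sigma> u h + smul c (conv \<sigma> u u))"
      unfolding v_def using hL uL by (simp add: conv_add_right conv_smul_right L1_smul)
    also have "\<dots> = unit_seq"
      unfolding hu u(3) using that by (simp add: fun_eq_iff distrib_left flip: mult.assoc)
    finally show ?thesis .
  qed
  from this[of "\<i>"] this[of "- \<i>"]
  have "p (v \<i>) \<le> 1" "p (v (- \<i>)) \<le> 1"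
    by (simp_all add: cstar_unitary_le_1 vA vstar)
  moreover have "h = smul (1 / 2) (v \<i> + v (- \<i>))"
    by (simp add: v_def fun_eq_iff)
  then have "p h = p (v \<i> + v (- \<i>)) / 2"
    using cstar_smul[OF add_mem[OF vA[of \<i>] vA[of "- \<i>"]], of "1 / 2"] by simp
  ultimately show ?thesis
    using cstar_add[OF vA[of \<i>] vA[of "- \<i>"]] by simp
qed

text \<open>Scaling extends the bound from the open unit ball to all self-adjoint elements, and the
  C*-identity transfers it from \<open>conv \<sigma> (invol \<sigma> a) a\<close> to
  \<open>a\<close>.\<close>

lemma cstar_le_l1norm:
  assumes a: "a \<in> A"
  shows "p a \<le> l1norm a"
proof -
  have sa: "p h \<le> l1norm h" if h: "h \<in> A" "invol \<sigma> h = h" for h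
  proof (rule dense_ge)
    fix r assume r: "l1norm h < r"
    then have r0: "0 < r"
      using l1norm_nonneg[OF mem_L1[OF h(1)]] by linarith
    have "l1norm (smul (1 / of_real r) h) < 1"
      using r r0 L1_smul(2)[OF mem_L1[OF h(1)], of "1 / of_real r"] by (simp add: norm_divide)
    then have "p (smul (1 / of_real r) h) \<le> 1"
      using h by (intro cstar_selfadjoint_le_1 smul_mem) (auto simp: invol_smul)
    then show "p h \<le> r"
      using r0 cstar_smul[OF h(1), of "1 / of_real r"] by (simp add: norm_divide field_simps)
  qed
  have aL: "a \<in> L1" using a mem_L1 by blast
  have "(p a)\<^sup>2 \<le> l1norm (conv \<sigma> (invol \<sigma> a) a)"
    using sa[OF conv_mem[OF invol_mem[OF a] a]] by (simp add: cstar_square[OF a] invol_conv)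
  also have "\<dots> \<le> (l1norm a)\<^sup>2"
    using l1norm_conv[OF invol_L1(1)[OF aL] aL] by (simp add: invol_L1(2)[OF aL] power2_eq_square)
  finally show ?thesis
    using l1norm_nonneg[OF aL] by (rule power2_le_imp_le)
qed

end

end

section \<open>The regular C*-seminorm\<close>

context compact_dynsys
begin

lemma L1_subalgebra: "l1_subalgebra \<sigma> L1"
  by unfold_locales
    (auto intro: unit_L1 L1_add L1_smul conv_L1 invol_L1 L1_multiplier)

text \<open>The form of the regular representation on the orbit of \<open>x\<close>: its diagonal is
  \<open>(b\<^sup>* b)\<^sub>0(x) = \<Sum>\<^sub>k |b\<^sub>k(\<sigma>\<^sup>k x)|\<^sup>2\<close>.\<close>
definition ip :: "'a \<Rightarrow> 'a seq \<Rightarrow> 'a seq \<Rightarrow> complex" where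
  "ip x b c = conv \<sigma> (invol \<sigma> b) c 0 x"

definition nrm :: "'a \<Rightarrow> 'a seq \<Rightarrow> real" where
  "nrm x b = sqrt (Re (ip x b b))"

lemma ip_add_right: "\<lbrakk>b \<in> L1; c \<in> L1; d \<in> L1\<rbrakk> \<Longrightarrow> ip x b (c + d) = ip x b c + ip x b d"
  by (simp add: ip_def conv_add_right invol_L1)

lemma ip_add_left: "\<lbrakk>b \<in> L1; c \<in> L1; d \<in> L1\<rbrakk> \<Longrightarrow> ip x (c + d) b = ip x c b + ip x d b"
  by (simp add: ip_def conv_add_left invol_L1 invol_add)

lemma ip_diff_right: "\<lbrakk>b \<in> L1; c \<in> L1; d \<in> L1\<rbrakk> \<Longrightarrow> ip x b (c - d) = ip x b c - ip x b d"
  by (simp add: ip_def conv_diff_right invol_L1)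

lemma ip_smul_right: "ip x b (smul t c) = t * ip x b c"
  by (simp add: ip_def conv_smul_right)

lemma ip_smul_left: "ip x (smul t b) c = cnj t * ip x b c"
  by (simp add: ip_def conv_smul_left invol_smul)

lemma ip_cnj: "ip x c b = cnj (ip x b c)"
proof -
  have "ip x c b = invol \<sigma> (conv \<sigma> (invol \<sigma> b) c) 0 x"
    by (simp add: ip_def invol_conv)
  also have "\<dots> = cnj (ip x b c)"
    by (simp add: ip_def invol_apply[of "conv \<sigma> (invol \<sigma> b) c"])
  finally show ?thesis .
qed

text \<open>Associativity makes left multiplication a *-representation for each form; the
  C*-identity of \<open>reg_norm\<close> rests on this.\<close>

lemma ip_conv_left: "\<lbrakk>a \<in> L1; b \<in> L1; c \<in> L1\<rbrakk> \<Longrightarrow> ip x (conv \<sigma> a b) c = ip x b (conv \<sigma> (invol \<sigma> a) c)"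
  by (simp add: ip_def invol_conv conv_assoc invol_L1)

text \<open>The diagonal is a series of nonnegative terms, so it is real and dominates each single
  term. The latter will bound coefficients by an operator norm.\<close>

lemma ip_self:
  assumes b: "b \<in> L1"
  shows "ip x b b = of_real (Re (ip x b b))" "(cmod (b k (spow \<sigma> k x)))\<^sup>2 \<le> Re (ip x b b)"
proof -
  define f where "f j = (cmod (b (- j) (spow \<sigma> (- j) x)))\<^sup>2" for j
  have eq: "invol \<sigma> b j x * b (0 - j) (spow \<sigma> (- j) x) = of_real (f j)" for j
    using complex_norm_square[of "b (- j) (spow \<sigma> (- j) x)"]
    by (simp add: invol_apply f_def mult.commute)
  have "(\<lambda>j. complex_of_real (f j)) summable_on UNIV"
    using conv_summable[OF invol_L1(1)[OF b] b, of x 0 "\<lambda>j. spow \<sigma> (- j) x"] unfolding eq .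
  then have s: "f summable_on UNIV"
    using summable_on_Re[of "\<lambda>j. complex_of_real (f j)"] by simp
  have ip: "ip x b b = of_real (infsum f UNIV)"
    unfolding ip_def conv_apply eq using s by (simp add: infsumI has_sum_of_real_iff)
  then show "ip x b b = of_real (Re (ip x b b))" by simp
  have "f (- k) \<le> infsum f UNIV"
    using finite_sum_le_infsum[OF s, of "{- k}"] by (simp add: f_def)
  then show "(cmod (b k (spow \<sigma> k x)))\<^sup>2 \<le> Re (ip x b b)"
    by (simp add: ip f_def)
qed

lemma ip_self_nonneg: "b \<in> L1 \<Longrightarrow> 0 \<le> Re (ip x b b)"
  using ip_self(2)[of b 0 x] by (meson order_trans zero_le_power2)

lemma nrm_nonneg: "b \<in> L1 \<Longrightarrow> 0 \<le> nrm x b"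
  by (simp add: nrm_def ip_self_nonneg)

lemma nrm_square: "b \<in> L1 \<Longrightarrow> (nrm x b)\<^sup>2 = Re (ip x b b)"
  by (simp add: nrm_def ip_self_nonneg)

lemma ip_Cauchy_Schwarz:
  assumes b: "b \<in> L1" and c: "c \<in> L1"
  shows "cmod (ip x b c) \<le> nrm x b * nrm x c"
proof -
  define I where "I = ip x b c"
  have ineq: "0 \<le> Re (ip x b b) - 2 * s * (cmod I)\<^sup>2 + s\<^sup>2 * (cmod I)\<^sup>2 * Re (ip x c c)" for s
  proof -
    \<comment> \<open>This phase makes each cross term \<open>- s\<close> times the squared modulus
      of \<open>I\<close>, so that positivity of the form becomes a real quadratic inequality in
      \<open>s\<close>.\<close>
    define t where "t = - (of_real s * cnj I)"
    have tc: "smul t c \<in> L1" using c L1_smul by blast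
    have tI: "t * I = - of_real (s * (cmod I)\<^sup>2)"
      using complex_norm_square[of I] by (simp add: t_def mult.commute mult.left_commute)
    have "cnj t * t = of_real (s\<^sup>2 * (cmod I)\<^sup>2)"
      using complex_norm_square[of I] by (simp add: t_def power2_eq_square)
    moreover have "ip x (b + smul t c) (b + smul t c)
        = ip x b b + t * I + cnj (t * I) + cnj t * t * ip x c c"
      using b c tc ip_cnj[of x c b]
      by (simp add: ip_add_left ip_add_right ip_smul_left ip_smul_right L1_add I_def distrib_left)
    ultimately have "Re (ip x (b + smul t c) (b + smul t c))
        = Re (ip x b b) - 2 * s * (cmod I)\<^sup>2 + s\<^sup>2 * (cmod I)\<^sup>2 * Re (ip x c c)"
      by (simp add: tI)
    then show ?thesis
      using ip_self_nonneg[OF L1_add(1)[OF b tc]] by metis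
  qed
  have "(cmod I)\<^sup>2 \<le> Re (ip x b b) * Re (ip x c c)"
  proof (cases "Re (ip x c c) = 0")
    case True
    have "(cmod I)\<^sup>2 = 0"
    proof (rule ccontr)
      assume "(cmod I)\<^sup>2 \<noteq> 0"
      \<comment> \<open>The quadratic term vanishes here, so the inequality is affine in
        \<open>s\<close> and fails at the chosen value.\<close>
      then show False
        using ineq[of "(Re (ip x b b) + 1) / (cmod I)\<^sup>2"] ip_self_nonneg[OF b, of x] True by simp
    qed
    then show ?thesis using True by simp
  next
    case False
    then have "0 < Re (ip x c c)"
      using ip_self_nonneg[OF c, of x] by simp
    then show ?thesis
      using ineq[of "1 / Re (ip x c c)"] by (simp add: field_simps power2_eq_square)
  qed
  then have "(cmod I)\<^sup>2 \<le> (nrm x b * nrm x c)\<^sup>2"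
    by (simp add: power_mult_distrib nrm_square b c)
  then show ?thesis
    unfolding I_def by (rule power2_le_imp_le) (simp add: nrm_nonneg b c)
qed

lemma nrm_add:
  assumes b: "b \<in> L1" and c: "c \<in> L1"
  shows "nrm x (b + c) \<le> nrm x b + nrm x c"
proof (rule power2_le_imp_le)
  have "(nrm x (b + c))\<^sup>2 = Re (ip x b b) + 2 * Re (ip x b c) + Re (ip x c c)"
    using b c ip_cnj[of x c b] by (simp add: nrm_square ip_add_left ip_add_right L1_add)
  also have "\<dots> \<le> (nrm x b)\<^sup>2 + 2 * (nrm x b * nrm x c) + (nrm x c)\<^sup>2"
    using complex_Re_le_cmod[of "ip x b c"] ip_Cauchy_Schwarz[OF b c, of x] by (simp add: nrm_square b c)
  finally show "(nrm x (b + c))\<^sup>2 \<le> (nrm x b + nrm x c)\<^sup>2"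
    by (simp add: power2_sum)
qed (simp add: nrm_nonneg b c)

lemma nrm_smul: "nrm x (smul t b) = cmod t * nrm x b"
proof -
  have "ip x (smul t b) (smul t b) = of_real ((cmod t)\<^sup>2) * ip x b b"
    using complex_norm_square[of t] by (simp add: ip_smul_left ip_smul_right mult.commute)
  then show ?thesis
    by (simp add: nrm_def real_sqrt_mult)
qed

text \<open>With \<open>u\<close> a self-adjoint square root of \<open>unit_seq - h\<close>, the
  square of \<open>nrm x b\<close> exceeds that of \<open>nrm x (conv \<sigma> a b)\<close> by the
  square of \<open>nrm x (conv \<sigma> u b)\<close>.\<close>

lemma nrm_conv_contractive:
  assumes a: "a \<in> L1" "l1norm a < 1" and b: "b \<in> L1"
  shows "nrm x (conv \<sigma> a b) \<le> nrm x b"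
proof -
  define h where "h = conv \<sigma> (invol \<sigma> a) a"
  have hL: "h \<in> L1"
    unfolding h_def using a by (intro conv_L1 invol_L1)
  have "l1norm h \<le> l1norm a * l1norm a"
    using l1norm_conv[OF invol_L1(1)[OF a(1)] a(1)] by (simp add: h_def invol_L1 a)
  also have "\<dots> < 1"
    using a mult_strict_mono'[of "l1norm a" 1 "l1norm a" 1] l1norm_nonneg[OF a(1)] by simp
  finally obtain u where u: "u \<in> L1" "invol \<sigma> u = u" "conv \<sigma> u u = unit_seq - h"
    using l1_subalgebra.sqrt_one_minus[OF L1_subalgebra hL] by (auto simp: h_def invol_conv)
  have "ip x (conv \<sigma> a b) (conv \<sigma> a b) = ip x b (conv \<sigma> h b)"
    using a b by (simp add: ip_conv_left conv_L1 h_def conv_assoc invol_L1)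
  also have "conv \<sigma> h b = b - conv \<sigma> (conv \<sigma> u u) b"
    using b hL unit_L1 by (simp add: u(3) conv_diff_left)
  also have "ip x b (b - conv \<sigma> (conv \<sigma> u u) b) = ip x b b - ip x (conv \<sigma> u b) (conv \<sigma> u b)"
    using b u(1,2) by (simp add: ip_diff_right ip_conv_left conv_L1 conv_assoc)
  finally show ?thesis
    using ip_self_nonneg[OF conv_L1[OF u(1) b]] by (simp add: nrm_def)
qed

text \<open>The operator norm in the direct sum of the regular representations on all orbits, tested
  on vectors from \<open>L1\<close>. Taking the infimum of bounds avoids division by
  \<open>nrm x b\<close>.\<close>

definition reg_norm :: "'a seq \<Rightarrow> real" where
  "reg_norm a = Inf {C. 0 \<le> C \<and> (\<forall>b\<in>L1. \<forall>x. nrm x (conv \<sigma> a b) \<le> C * nrm x b)}"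

lemma reg_norm_le:
  assumes "0 \<le> C" "\<And>b x. b \<in> L1 \<Longrightarrow> nrm x (conv \<sigma> a b) \<le> C * nrm x b"
  shows "reg_norm a \<le> C"
  unfolding reg_norm_def using assms by (intro cInf_lower bdd_belowI[where m = 0]) auto

context
  fixes a :: "'a seq"
  assumes a: "a \<in> L1"
begin

text \<open>Dividing by a number strictly above \<open>l1norm a\<close> reduces to the contractive
  case; the added 1 also keeps the divisor positive for \<open>a = 0\<close>. The set of bounds is
  thereby nonempty.\<close>

private lemma reg_norm_bounded:
  "l1norm a + 1 \<in> {C. 0 \<le> C \<and> (\<forall>b\<in>L1. \<forall>x. nrm x (conv \<sigma> a b) \<le> C * nrm x b)}"
proof -
  define r where "r = l1norm a + 1"
  have r: "0 < r" "l1norm a < r"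
    using l1norm_nonneg[OF a] by (auto simp: r_def)
  have "nrm x (conv \<sigma> a b) \<le> r * nrm x b" if b: "b \<in> L1" for b x
  proof -
    have "l1norm (smul (1 / of_real r) a) < 1"
      using L1_smul(2)[OF a, of "1 / of_real r"] r by (simp add: norm_divide)
    then have "nrm x (smul (1 / of_real r) (conv \<sigma> a b)) \<le> nrm x b"
      using nrm_conv_contractive[OF L1_smul(1)[OF a] _ b, of "1 / of_real r"] by (simp add: conv_smul_left)
    then show ?thesis
      using r by (simp add: nrm_smul norm_divide field_simps)
  qed
  then show ?thesis
    using r by (simp add: r_def)
qed

lemma reg_norm_nonneg: "0 \<le> reg_norm a"
  unfolding reg_norm_def using reg_norm_bounded by (intro cInf_greatest) auto

lemma nrm_conv_le:
  assumes b: "b \<in> L1"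
  shows "nrm x (conv \<sigma> a b) \<le> reg_norm a * nrm x b"
proof (cases "nrm x b = 0")
  \<comment> \<open>\<open>nrm x b\<close> sees \<open>b\<close> only along the orbit of
    \<open>x\<close> and may vanish for nonzero \<open>b\<close>; any finite bound then forces the
    left side to be at most 0.\<close>
  case True
  then show ?thesis
    using reg_norm_bounded b by (metis (mono_tags, lifting) mem_Collect_eq mult_zero_right)
next
  case False
  then have "0 < nrm x b"
    using nrm_nonneg[OF b, of x] by simp
  then have "nrm x (conv \<sigma> a b) / nrm x b \<le> reg_norm a"
    unfolding reg_norm_def using reg_norm_bounded b
    by (intro cInf_greatest) (auto simp: divide_le_eq)
  then show ?thesis
    using \<open>0 < nrm x b\<close> by (simp add: divide_le_eq)
qed

text \<open>\<open>unit_seq\<close> is a unit vector for every form, and its image \<open>a\<close>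
  has the entry \<open>a k y\<close> in degree \<open>k\<close> when the base point \<open>x\<close>
  satisfies \<open>spow \<sigma> k x = y\<close>.\<close>

lemma supn_le_reg_norm: "supn (a k) \<le> reg_norm a"
proof (rule supn_le)
  fix y
  define x where "x = spow \<sigma> (- k) y"
  have "ip x unit_seq unit_seq = 1"
    by (simp add: ip_def delta_apply)
  then have "nrm x unit_seq = 1"
    by (simp add: nrm_def)
  then have "nrm x a \<le> reg_norm a"
    using nrm_conv_le[OF unit_L1, of x] by simp
  moreover have "cmod (a k y) \<le> nrm x a"
    using ip_self(2)[OF a, of k x] by (simp add: nrm_def x_def real_le_rsqrt)
  ultimately show "cmod (a k y) \<le> reg_norm a" by simp
qed

lemma reg_norm_smul_le: "reg_norm (smul t a) \<le> cmod t * reg_norm a"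
  using nrm_conv_le reg_norm_nonneg
  by (intro reg_norm_le) (auto simp: conv_smul_left nrm_smul mult.assoc mult_left_mono)

end

lemma reg_norm_square_le:
  assumes a: "a \<in> L1"
  shows "(reg_norm a)\<^sup>2 \<le> reg_norm (conv \<sigma> (invol \<sigma> a) a)"
proof -
  define h where "h = conv \<sigma> (invol \<sigma> a) a"
  have hL: "h \<in> L1"
    unfolding h_def using a by (intro conv_L1 invol_L1)
  have "nrm x (conv \<sigma> a b) \<le> sqrt (reg_norm h) * nrm x b" if b: "b \<in> L1" for b x
  proof (rule power2_le_imp_le)
    have "(nrm x (conv \<sigma> a b))\<^sup>2 = Re (ip x b (conv \<sigma> h b))"
      using a b by (simp add: nrm_square ip_conv_left conv_L1 h_def conv_assoc invol_L1)
    also have "\<dots> \<le> nrm x b * nrm x (conv \<sigma> h b)"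
      using complex_Re_le_cmod ip_Cauchy_Schwarz[OF b conv_L1[OF hL b]] order_trans by blast
    also have "\<dots> \<le> nrm x b * (reg_norm h * nrm x b)"
      by (intro mult_left_mono nrm_conv_le nrm_nonneg hL b)
    also have "\<dots> = (sqrt (reg_norm h) * nrm x b)\<^sup>2"
      by (simp add: power_mult_distrib reg_norm_nonneg[OF hL]) (simp add: power2_eq_square)
    finally show "(nrm x (conv \<sigma> a b))\<^sup>2 \<le> (sqrt (reg_norm h) * nrm x b)\<^sup>2" .
  qed (simp add: reg_norm_nonneg hL nrm_nonneg b)
  then have "reg_norm a \<le> sqrt (reg_norm h)"
    by (intro reg_norm_le) (simp_all add: reg_norm_nonneg hL)
  then have "(reg_norm a)\<^sup>2 \<le> (sqrt (reg_norm h))\<^sup>2"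
    by (intro power_mono reg_norm_nonneg a)
  then show ?thesis
    by (simp add: reg_norm_nonneg[OF hL] flip: h_def)
qed

lemma reg_norm_conv_le:
  assumes a: "a \<in> L1" and b: "b \<in> L1"
  shows "reg_norm (conv \<sigma> a b) \<le> reg_norm a * reg_norm b"
proof (rule reg_norm_le)
  fix c :: "'a seq" and x assume c: "c \<in> L1"
  have "nrm x (conv \<sigma> (conv \<sigma> a b) c) \<le> reg_norm a * nrm x (conv \<sigma> b c)"
    using a b c by (simp add: conv_assoc nrm_conv_le conv_L1)
  also have "\<dots> \<le> reg_norm a * (reg_norm b * nrm x c)"
    by (intro mult_left_mono nrm_conv_le reg_norm_nonneg a b c)
  finally show "nrm x (conv \<sigma> (conv \<sigma> a b) c) \<le> reg_norm a * reg_norm b * nrm x c"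
    by (simp add: mult.assoc)
qed (simp add: a b reg_norm_nonneg)

lemma reg_norm_invol_ge:
  assumes a: "a \<in> L1"
  shows "reg_norm a \<le> reg_norm (invol \<sigma> a)"
proof -
  have "(reg_norm a)\<^sup>2 \<le> reg_norm (invol \<sigma> a) * reg_norm a"
    using reg_norm_square_le[OF a] reg_norm_conv_le[OF invol_L1(1)[OF a] a] by linarith
  then show ?thesis
    using reg_norm_nonneg[OF a] reg_norm_nonneg[OF invol_L1(1)[OF a]]
    by (cases "reg_norm a = 0") (auto simp: power2_eq_square)
qed

lemma reg_norm_cstar: "cstar_seminorm \<sigma> L1 reg_norm"
  unfolding cstar_seminorm_def sadd_eq_plus
proof (intro conjI ballI allI)
  fix a b :: "'a seq" and c
  assume a: "a \<in> L1"
  show "0 \<le> reg_norm a"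
    by (rule reg_norm_nonneg[OF a])
  show "reg_norm (smul c a) = cmod c * reg_norm a"
  proof (cases "c = 0")
    case True
    then show ?thesis
      using reg_norm_smul_le[OF a, of c] reg_norm_nonneg[OF L1_smul(1)[OF a], of c] by simp
  next
    case False
    then have "smul (1 / c) (smul c a) = a"
      by (simp add: fun_eq_iff)
    then have "reg_norm a \<le> cmod (1 / c) * reg_norm (smul c a)"
      using reg_norm_smul_le[OF L1_smul(1)[OF a], of "1 / c" c] by simp
    then show ?thesis
      using reg_norm_smul_le[OF a, of c] False by (simp add: norm_divide field_simps)
  qed
  have "reg_norm (invol \<sigma> a) \<le> reg_norm a"
    using reg_norm_invol_ge[OF invol_L1(1)[OF a]] by simp
  then have "reg_norm (invol \<sigma> a) * reg_norm a \<le> (reg_norm a)\<^sup>2"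
    using reg_norm_nonneg[OF a] by (simp add: power2_eq_square mult_right_mono)
  then show "reg_norm (conv \<sigma> (invol \<sigma> a) a) = (reg_norm a)\<^sup>2"
    using reg_norm_square_le[OF a] reg_norm_conv_le[OF invol_L1(1)[OF a] a] by linarith
  assume b: "b \<in> L1"
  show "reg_norm (conv \<sigma> a b) \<le> reg_norm a * reg_norm b"
    by (rule reg_norm_conv_le[OF a b])
  show "reg_norm (a + b) \<le> reg_norm a + reg_norm b"
  proof (rule reg_norm_le)
    fix d :: "'a seq" and x assume d: "d \<in> L1"
    show "nrm x (conv \<sigma> (a + b) d) \<le> (reg_norm a + reg_norm b) * nrm x d"
      using a b d nrm_add[OF conv_L1[OF a d] conv_L1[OF b d], of x] nrm_conv_le[OF a d, of x]
        nrm_conv_le[OF b d, of x] by (simp add: conv_add_left distrib_right)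
  qed (simp add: a b reg_norm_nonneg)
qed

end

section \<open>C*-seminorms on subalgebras\<close>

text \<open>If \<open>y < x\<close>, powers of the ratio outgrow any factor linear in the exponent.
  In the application the factor counts the integers of modulus at most \<open>2 ^ m * K\<close>, the
  degrees available to the power \<open>2 ^ m\<close> of an element supported in degrees up to
  \<open>K\<close>.\<close>

lemma le_if_power_le_linear:
  fixes x y K :: real
  assumes x: "0 \<le> x" and y: "0 \<le> y"
    and le: "\<And>m. x ^ (2 ^ m) \<le> (2 * (2 ^ m * K) + 1) * y ^ (2 ^ m)"
  shows "x \<le> y"
proof (rule ccontr)
  assume "\<not> x \<le> y"
  then have xy: "y < x" by simp
  have "y \<noteq> 0"
    using le[of 0] xy by auto
  then have y0: "0 < y" using y by simp
  define r where "r = x / y"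
  have r: "1 < r"
    using xy y0 by (simp add: r_def)
  have bound: "1 \<le> 2 * K * (real (2 ^ m) / r ^ (2 ^ m)) + 1 / r ^ (2 ^ m)" for m :: nat
  proof -
    have "r ^ (2 ^ m) \<le> 2 * (2 ^ m * K) + 1"
      using le[of m] y0 by (simp add: r_def power_divide divide_le_eq)
    then show ?thesis
      using r by (simp add: divide_simps mult.commute mult.left_commute)
  qed
  have sub: "strict_mono (\<lambda>m::nat. (2::nat) ^ m)"
    by (rule strict_monoI) simp
  have "(\<lambda>n. real n / r ^ n) \<longlonglongrightarrow> 0"
    using lim_n_over_pown[of r] r by simp
  moreover have "(\<lambda>n. 1 / r ^ n) \<longlonglongrightarrow> 0"
    using LIMSEQ_divide_realpow_zero[of r 1] r by simp
  ultimately have "(\<lambda>n. 2 * K * (real n / r ^ n) + 1 / r ^ n) \<longlonglongrightarrow> 2 * K * 0 + 0"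
    by (intro tendsto_intros)
  from LIMSEQ_subseq_LIMSEQ[OF this sub]
  have "(\<lambda>m. 2 * K * (real (2 ^ m) / r ^ (2 ^ m)) + 1 / r ^ (2 ^ m)) \<longlonglongrightarrow> 0"
    by (simp add: o_def)
  then have "1 \<le> (0::real)"
    by (rule tendsto_lowerbound) (use bound in \<open>auto simp del: of_nat_power\<close>)
  then show False by simp
qed

text \<open>The zero seminorm is always a competitor, so the \<open>Sup\<close> is taken over a
  nonempty set.\<close>

lemma env_least:
  assumes "\<And>p. cstar_seminorm \<sigma> A p \<Longrightarrow> p a \<le> C"
  shows "env \<sigma> A a \<le> C"
proof -
  have "cstar_seminorm \<sigma> A (\<lambda>_. 0)"
    by (simp add: cstar_seminorm_def)
  then show ?thesis
    unfolding env_def using assms by (intro cSup_least) auto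
qed

context compact_dynsys
begin

text \<open>Dominated convergence by hand: a finite set \<open>F\<close> carries all but
  \<open>e / 4\<close> of the norm, off \<open>F\<close> the factor \<open>1 - w n k\<close> has
  modulus at most 2, and on \<open>F\<close> only finitely many weights have to converge.\<close>

lemma multiplier_tendsto:
  fixes w :: "nat \<Rightarrow> int \<Rightarrow> complex"
  assumes a: "(a::'a seq) \<in> L1" and w: "\<And>n k. cmod (w n k) \<le> 1" and lim: "\<And>k. (\<lambda>n. w n k) \<longlonglongrightarrow> 1"
  shows "(\<lambda>n. l1norm (a - multiplier (w n) a)) \<longlonglongrightarrow> 0"
proof (rule LIMSEQ_I)
  fix e :: real assume e: "0 < e"
  have dL: "a - multiplier (w n) a \<in> L1" for n
    by (rule L1_diff(1)[OF a L1_multiplier(1)[of a "w n" 1, OF a w]])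
  define f where "f k = supn (a k)" for k
  have f: "f summable_on UNIV" "\<And>k. 0 \<le> f k"
    using L1_D(3,5)[OF a] by (simp_all add: f_def[abs_def])
  have "((\<lambda>F. sum f F) \<longlongrightarrow> infsum f UNIV) (finite_subsets_at_top UNIV)"
    by (rule infsum_tendsto[OF f(1)])
  then have "\<forall>\<^sub>F F in finite_subsets_at_top UNIV. dist (sum f F) (infsum f UNIV) < e / 4"
    using e by (intro tendstoD) auto
  then obtain F where F: "finite F" "dist (sum f F) (infsum f UNIV) < e / 4"
    unfolding eventually_finite_subsets_at_top by blast
  have split: "infsum g UNIV = sum g F + infsum g (- F)" if "g summable_on UNIV" for g :: "int \<Rightarrow> real"
    using infsum_Un_disjoint[of g F "- F"] summable_on_subset_banach[OF that] F(1) by simp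
  have tail: "infsum f (- F) < e / 4"
    using F(2) split[OF f(1)] by (simp add: dist_real_def abs_less_iff)
  have "(\<lambda>n. \<Sum>k\<in>F. cmod (1 - w n k) * f k) \<longlonglongrightarrow> (\<Sum>k\<in>F. cmod (1 - 1) * f k)"
    by (intro tendsto_intros lim)
  then have "(\<lambda>n. \<Sum>k\<in>F. cmod (1 - w n k) * f k) \<longlonglongrightarrow> 0" by simp
  then have "\<forall>\<^sub>F n in sequentially. (\<Sum>k\<in>F. cmod (1 - w n k) * f k) < e / 4"
    using e by (intro order_tendstoD(2)) auto
  then obtain N where N: "\<And>n. N \<le> n \<Longrightarrow> (\<Sum>k\<in>F. cmod (1 - w n k) * f k) < e / 4"
    unfolding eventually_sequentially by blast
  have "l1norm (a - multiplier (w n) a) < e" if n: "N \<le> n" for n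
  proof -
    define g where "g k = cmod (1 - w n k) * f k" for k
    have g2: "g k \<le> 2 * f k" for k
      unfolding g_def using norm_triangle_ineq4[of 1 "w n k"] w[of n k] f(2)[of k]
      by (intro mult_right_mono) auto
    have gs: "g summable_on UNIV"
      by (rule summable_on_comparison_test[OF summable_on_cmult_right[OF f(1), of 2]])
        (use g2 f(2) in \<open>auto simp: g_def\<close>)
    have eq: "a - multiplier (w n) a = multiplier (\<lambda>k. 1 - w n k) a"
      by (simp add: fun_eq_iff left_diff_distrib)
    have "l1norm (a - multiplier (w n) a) \<le> infsum g UNIV"
    proof (rule L1_dominated(2)[OF _ _ gs])
      show "continuous_on UNIV ((a - multiplier (w n) a) k)" for k
        by (rule L1_D(2)[OF dL])
      show "cmod ((a - multiplier (w n) a) k x) \<le> g k" for k x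
        unfolding eq using L1_D(4)[OF a, of k x] by (simp add: norm_mult g_def f_def mult_left_mono)
    qed
    moreover have "infsum g UNIV = sum g F + infsum g (- F)"
      by (rule split[OF gs])
    moreover have "infsum g (- F) \<le> infsum (\<lambda>k. 2 * f k) (- F)"
      using f(1) gs by (intro infsum_mono g2 summable_on_subset_banach[OF gs]
          summable_on_subset_banach[OF summable_on_cmult_right[OF f(1), of 2]]) auto
    moreover have "infsum (\<lambda>k. 2 * f k) (- F) = 2 * infsum f (- F)"
      by (simp add: infsum_cmult_right')
    moreover have "sum g F < e / 4"
      using N[OF n] by (simp add: g_def)
    ultimately show ?thesis
      using tail e by linarith
  qed
  then show "\<exists>N. \<forall>n\<ge>N. norm (l1norm (a - multiplier (w n) a) - 0) < e"
    using l1norm_nonneg[OF dL] by (intro exI[of _ N]) simp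
qed

definition trunc :: "nat \<Rightarrow> 'a seq \<Rightarrow> 'a seq" where
  "trunc K = multiplier (\<lambda>k. if \<bar>k\<bar> \<le> int K then 1 else 0)"

definition supported_in :: "int \<Rightarrow> 'a seq \<Rightarrow> bool" where
  "supported_in K a \<longleftrightarrow> (\<forall>k x. K < \<bar>k\<bar> \<longrightarrow> a k x = 0)"

lemma trunc_supported: "supported_in (int K) (trunc K a)"
  by (simp add: trunc_def supported_in_def)

lemma trunc_L1: "a \<in> L1 \<Longrightarrow> trunc K a \<in> L1"
  unfolding trunc_def by (rule L1_multiplier(1)[where c = 1]) auto

lemma trunc_tendsto: "a \<in> L1 \<Longrightarrow> (\<lambda>K. l1norm (a - trunc K a)) \<longlonglongrightarrow> 0"
  unfolding trunc_def
proof (rule multiplier_tendsto)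
  fix k :: int
  have "\<forall>\<^sub>F K in sequentially. (if \<bar>k\<bar> \<le> int K then 1 else 0) = (1::complex)"
    by (rule eventually_sequentiallyI[of "nat \<bar>k\<bar>"]) auto
  then show "(\<lambda>K. if \<bar>k\<bar> \<le> int K then 1 else 0) \<longlonglongrightarrow> (1::complex)"
    by (rule tendsto_eventually)
qed auto

lemma supported_conv:
  assumes "supported_in K a" "supported_in L b"
  shows "supported_in (K + L) (conv \<sigma> a b)"
  unfolding supported_in_def
proof (intro allI impI)
  fix n x assume "K + L < \<bar>n\<bar>"
  then have "K < \<bar>k\<bar> \<or> L < \<bar>n - k\<bar>" for k by linarith
  then have "a k x * b (n - k) y = 0" for k y
    using assms unfolding supported_in_def by (metis mult_zero_left mult_zero_right)
  then show "conv \<sigma> a b n x = 0"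
    by (simp only: conv_apply infsum_0_simp)
qed

lemma supported_invol: "supported_in K a \<Longrightarrow> supported_in K (invol \<sigma> a)"
  by (simp add: supported_in_def invol_apply)

lemma l1norm_supported_le:
  assumes "a \<in> L1" "supported_in K a" "0 \<le> K" "\<And>k. supn (a k) \<le> C"
  shows "l1norm a \<le> (2 * K + 1) * C"
proof -
  have "l1norm a = (\<Sum>k\<in>{- K..K}. supn (a k))"
    using assms by (intro L1_finite_support) (auto simp: supported_in_def L1_D fun_eq_iff)
  also have "\<dots> \<le> of_nat (card {- K..K}) * C"
    using assms(4) by (intro sum_bounded_above) auto
  also have "\<dots> = (2 * K + 1) * C"
    using assms(3) by simp
  finally show ?thesis by simp
qed

end

section \<open>The enveloping seminorm of a closed subalgebra\<close>

context l1_subalgebra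
begin

text \<open>\<open>cstar_le_l1norm\<close> bounds the set of values, without which the real
  \<open>Sup\<close> need not be an upper bound.\<close>

lemma cstar_le_env: "\<lbrakk>cstar_seminorm \<sigma> A p; a \<in> A\<rbrakk> \<Longrightarrow> p a \<le> env \<sigma> A a"
  unfolding env_def using cstar_le_l1norm by (intro cSup_upper bdd_aboveI[where M = "l1norm a"]) auto

lemma env_nonneg: "a \<in> A \<Longrightarrow> 0 \<le> env \<sigma> A a"
  by (rule cstar_le_env[of "\<lambda>_. 0"]) (simp add: cstar_seminorm_def)

lemma env_le_l1norm: "a \<in> A \<Longrightarrow> env \<sigma> A a \<le> l1norm a"
  using cstar_le_l1norm env_least by blast

lemma env_add: "\<lbrakk>a \<in> A; b \<in> A\<rbrakk> \<Longrightarrow> env \<sigma> A (a + b) \<le> env \<sigma> A a + env \<sigma> A b"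
  by (rule env_least, rule order_trans[OF cstar_add]) (auto intro: add_mono cstar_le_env)

lemma env_diff: "\<lbrakk>a \<in> A; b \<in> A\<rbrakk> \<Longrightarrow> env \<sigma> A (a - b) \<le> env \<sigma> A a + env \<sigma> A b"
  by (rule env_least, rule order_trans[OF cstar_diff]) (auto intro: add_mono cstar_le_env)

lemma env_smul: "a \<in> A \<Longrightarrow> env \<sigma> A (smul c a) \<le> cmod c * env \<sigma> A a"
  by (intro env_least) (simp add: cstar_smul cstar_le_env mult_left_mono)

lemma env_conv: "\<lbrakk>a \<in> A; b \<in> A\<rbrakk> \<Longrightarrow> env \<sigma> A (conv \<sigma> a b) \<le> env \<sigma> A a * env \<sigma> A b"
  by (rule env_least, rule order_trans[OF cstar_conv])
    (auto intro!: mult_mono cstar_le_env env_nonneg cstar_nonneg)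

lemma env_square: "a \<in> A \<Longrightarrow> env \<sigma> A (conv \<sigma> (invol \<sigma> a) a) \<le> (env \<sigma> A a)\<^sup>2"
  by (intro env_least) (simp add: cstar_square cstar_le_env cstar_nonneg power_mono)

end

context compact_dynsys
begin

interpretation full: l1_subalgebra \<sigma> L1
  by (rule L1_subalgebra)


lemma supn_le_env: "a \<in> L1 \<Longrightarrow> supn (a k) \<le> env \<sigma> L1 a"
  using supn_le_reg_norm full.cstar_le_env[OF reg_norm_cstar] order_trans by blast

end

section \<open>Comparison with the enveloping seminorm of the full algebra\<close>

context l1_subalgebra
begin

interpretation full: l1_subalgebra \<sigma> L1
  by (rule L1_subalgebra)

text \<open>Dyadic powers are used because the C*-identity evaluates \<open>p\<close> exactly on the
  square of a self-adjoint element; for general powers submultiplicativity alone points the wrong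
  way.\<close>

lemma cstar_selfadjoint_supported_le_env:
  assumes p: "cstar_seminorm \<sigma> A p" and h: "h \<in> A" "invol \<sigma> h = h" "supported_in (int K) h"
  shows "p h \<le> env \<sigma> L1 h"
proof (rule le_if_power_le_linear)
  show "0 \<le> p h" "0 \<le> env \<sigma> L1 h"
    using cstar_nonneg[OF p] full.env_nonneg mem_L1 h by auto
  fix m
  define g where "g m = ((\<lambda>a. conv \<sigma> a a) ^^ m) h" for m
  have g: "g m \<in> A \<and> invol \<sigma> (g m) = g m \<and> supported_in (2 ^ m * int K) (g m)
      \<and> p (g m) = p h ^ (2 ^ m) \<and> env \<sigma> L1 (g m) \<le> env \<sigma> L1 h ^ (2 ^ m)"
  proof (induction m)
    case 0
    then show ?case using h by (simp add: g_def)
  next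
    case (Suc m)
    have gS: "g (Suc m) = conv \<sigma> (g m) (g m)"
      by (simp add: g_def)
    have gL: "g m \<in> L1" using Suc mem_L1 by blast
    have "supported_in (2 ^ m * int K + 2 ^ m * int K) (g (Suc m))"
      unfolding gS using Suc supported_conv by blast
    moreover have "p (g (Suc m)) = p h ^ (2 ^ Suc m)"
      using cstar_square[OF p, of "g m"] Suc by (simp add: gS power_even_eq mult.commute)
    moreover have "env \<sigma> L1 (g (Suc m)) \<le> (env \<sigma> L1 (g m))\<^sup>2"
      using full.env_conv[OF gL gL] by (simp add: gS power2_eq_square)
    moreover have "(env \<sigma> L1 (g m))\<^sup>2 \<le> env \<sigma> L1 h ^ (2 ^ Suc m)"
      using power_mono[of "env \<sigma> L1 (g m)" "env \<sigma> L1 h ^ (2 ^ m)" 2] Suc full.env_nonneg[OF gL]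
      by (simp add: power_even_eq mult.commute)
    moreover have "g (Suc m) \<in> A" "invol \<sigma> (g (Suc m)) = g (Suc m)"
      unfolding gS using Suc by (simp_all add: conv_mem invol_conv)
    moreover have "2 ^ m * int K + 2 ^ m * int K = 2 ^ Suc m * int K"
      by simp
    ultimately show ?case
      by (metis order_trans)
  qed
  then have gL: "g m \<in> L1" using mem_L1 by blast
  have "p h ^ (2 ^ m) \<le> l1norm (g m)"
    using cstar_le_l1norm[OF p, of "g m"] g by simp
  also have "\<dots> \<le> (2 * of_int (2 ^ m * int K) + 1) * env \<sigma> L1 (g m)"
    using g gL supn_le_env by (intro l1norm_supported_le) auto
  also have "\<dots> \<le> (2 * of_int (2 ^ m * int K) + 1) * env \<sigma> L1 h ^ (2 ^ m)"
    using g by (intro mult_left_mono) auto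
  finally show "p h ^ (2 ^ m) \<le> (2 * (2 ^ m * real K) + 1) * env \<sigma> L1 h ^ (2 ^ m)"
    by simp
qed

text \<open>Self-adjointness is removed by passing to
  \<open>conv \<sigma> (invol \<sigma> b) b\<close>, finite support by truncation: \<open>p\<close>
  and \<open>env \<sigma> L1\<close> each change by at most the \<open>l1norm\<close> of the tail,
  hence the factor 2.\<close>

lemma cstar_le_envL1:
  assumes p: "cstar_seminorm \<sigma> A p" and a: "a \<in> A"
  shows "p a \<le> env \<sigma> L1 a"
proof -
  have aL: "a \<in> L1" using a mem_L1 by blast
  have fin: "p b \<le> env \<sigma> L1 b" if b: "b \<in> A" "supported_in (int K) b" for b K
  proof (rule power2_le_imp_le)
    have "supported_in (int (2 * K)) (conv \<sigma> (invol \<sigma> b) b)"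
      using supported_conv[OF supported_invol[OF b(2)] b(2)] by simp
    from cstar_selfadjoint_supported_le_env[OF p conv_mem[OF invol_mem[OF b(1)] b(1)] _ this]
    have "(p b)\<^sup>2 \<le> env \<sigma> L1 (conv \<sigma> (invol \<sigma> b) b)"
      by (simp add: invol_conv cstar_square[OF p b(1)])
    also have "\<dots> \<le> (env \<sigma> L1 b)\<^sup>2"
      by (intro full.env_square mem_L1 b)
    finally show "(p b)\<^sup>2 \<le> (env \<sigma> L1 b)\<^sup>2" .
    show "0 \<le> env \<sigma> L1 b"
      by (intro full.env_nonneg mem_L1 b)
  qed
  have "p a \<le> env \<sigma> L1 a + 2 * l1norm (a - trunc K a)" for K
  proof -
    have t: "trunc K a \<in> A"
      unfolding trunc_def using a by (intro multiplier_mem) auto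
    have d: "a - trunc K a \<in> A" using a t diff_mem by blast
    note dL = mem_L1[OF d]
    have "p a \<le> p (trunc K a) + p (a - trunc K a)"
      using cstar_add[OF p t d] by simp
    moreover have "p (trunc K a) \<le> env \<sigma> L1 (trunc K a)" "p (a - trunc K a) \<le> l1norm (a - trunc K a)"
      using fin[OF t trunc_supported] cstar_le_l1norm[OF p d] by auto
    moreover have "env \<sigma> L1 (trunc K a) \<le> env \<sigma> L1 a + l1norm (a - trunc K a)"
      using full.env_diff[OF aL dL] full.env_le_l1norm[OF dL] by simp
    ultimately show ?thesis by linarith
  qed
  moreover have "(\<lambda>K. env \<sigma> L1 a + 2 * l1norm (a - trunc K a)) \<longlonglongrightarrow> env \<sigma> L1 a + 2 * 0"
    by (intro tendsto_intros trunc_tendsto aL)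
  ultimately show ?thesis
    by (intro tendsto_lowerbound[of "\<lambda>K. env \<sigma> L1 a + 2 * l1norm (a - trunc K a)" _ sequentially]) auto
qed

lemma env_eq_envL1:
  assumes a: "a \<in> A"
  shows "env \<sigma> A a = env \<sigma> L1 a"
proof (rule antisym)
  show "env \<sigma> A a \<le> env \<sigma> L1 a"
    using cstar_le_envL1 a by (intro env_least) blast
  show "env \<sigma> L1 a \<le> env \<sigma> A a"
  proof (rule env_least)
    fix p assume "cstar_seminorm \<sigma> L1 p"
    then have "cstar_seminorm \<sigma> A p"
      using mem_L1 by (auto simp: cstar_seminorm_def)
    then show "p a \<le> env \<sigma> A a"
      using a cstar_le_env by blast
  qed
qed

end

section \<open>Fejer means and the commutant\<close>

text \<open>Orthogonality of characters of the cyclic group of order \<open>M\<close>; the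
  restriction on \<open>n\<close> excludes the nonzero multiples of \<open>M\<close>, for which the
  sum would again be \<open>M\<close>.\<close>

lemma sum_roots_of_unity:
  assumes "\<bar>n\<bar> < int M"
  shows "(\<Sum>j<M. cis (of_int n * (2 * pi * real j / real M))) = (if n = 0 then of_nat M else 0)"
proof -
  define z where "z = cis (2 * pi * of_int n / real M)"
  have M: "0 < M" using assms by auto
  have pow: "cis (of_int n * (2 * pi * real j / real M)) = z ^ j" for j
  proof -
    have "of_int n * (2 * pi * real j / real M) = real j * (2 * pi * of_int n / real M)"
      by simp
    then show ?thesis
      by (simp only: z_def Complex.DeMoivre)
  qed
  have "z ^ M = cis (2 * pi * of_int n)"
    using M by (simp add: z_def Complex.DeMoivre)
  then have zM: "z ^ M = 1"
    using cis_multiple_2pi[of "of_int n"] by simp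
  have z1: "z \<noteq> 1" if n: "n \<noteq> 0"
  proof
    assume "z = 1"
    then have "cos (2 * pi * of_int n / real M) = 1"
      by (simp add: z_def complex_eq_iff)
    then obtain m :: int where "2 * pi * of_int n / real M = of_int m * 2 * pi"
      using cos_one_2pi_int by auto
    then have "real_of_int n = of_int (m * int M)"
      using M by (simp add: field_simps)
    then have "n = m * int M"
      using of_int_eq_iff by blast
    then show False
      using assms n by (auto simp: abs_mult)
  qed
  show ?thesis
    unfolding pow
  proof (cases "n = 0")
    case True
    then have "z = 1" by (simp add: z_def)
    then show "(\<Sum>j<M. z ^ j) = (if n = 0 then of_nat M else 0)"
      using True by simp
  next
    case False
    then show "(\<Sum>j<M. z ^ j) = (if n = 0 then of_nat M else 0)"
      using zM z1 by (simp add: geometric_sum)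
  qed
qed

text \<open>For positive \<open>N\<close> this is 1 - |k| / N cut off at 0. Counting is the form in
  which it arises from the squared modulus of an exponential sum of length \<open>N\<close>.\<close>

definition fejer_weight :: "nat \<Rightarrow> int \<Rightarrow> complex" where
  "fejer_weight N k = of_nat (card {i \<in> {0..<int N}. i + k \<in> {0..<int N}}) / of_nat N"

lemma cmod_fejer_weight_le: "cmod (fejer_weight N k) \<le> 1"
proof -
  have "card {i \<in> {0..<int N}. i + k \<in> {0..<int N}} \<le> card {0..<int N}"
    by (intro card_mono) auto
  then show ?thesis
    by (simp add: fejer_weight_def norm_divide divide_le_eq)
qed

lemma fejer_weight_eq_0: "int N \<le> \<bar>k\<bar> \<Longrightarrow> fejer_weight N k = 0"
proof -
  assume "int N \<le> \<bar>k\<bar>"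
  then have "{i \<in> {0..<int N}. i + k \<in> {0..<int N}} = {}" by auto
  then show ?thesis by (simp add: fejer_weight_def del: Collect_empty_eq)
qed

lemma fejer_weight_0: "0 < N \<Longrightarrow> fejer_weight N 0 = 1"
proof -
  have "{i \<in> {0..<int N}. i + 0 \<in> {0..<int N}} = {0..<int N}" by auto
  then have "card {i \<in> {0..<int N}. i + 0 \<in> {0..<int N}} = N"
    by (simp only: card_atLeastLessThan_int diff_0_right nat_int)
  then show "0 < N \<Longrightarrow> fejer_weight N 0 = 1"
    by (simp only: fejer_weight_def) simp
qed

lemma fejer_weight_tendsto: "(\<lambda>N. fejer_weight N k) \<longlonglongrightarrow> 1"
proof -
  have eq: "fejer_weight N k = 1 - of_int \<bar>k\<bar> / of_nat N" if N: "nat \<bar>k\<bar> + 1 \<le> N" for N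
  proof -
    have "{i \<in> {0..<int N}. i + k \<in> {0..<int N}} = {max 0 (- k)..<min (int N) (int N - k)}"
      by auto
    then have card: "card {i \<in> {0..<int N}. i + k \<in> {0..<int N}}
        = nat (min (int N) (int N - k) - max 0 (- k))"
      by (simp only: card_atLeastLessThan_int)
    have "int (card {i \<in> {0..<int N}. i + k \<in> {0..<int N}}) = int N - \<bar>k\<bar>"
      unfolding card using N by (auto simp: max_def min_def)
    then have "(of_nat (card {i \<in> {0..<int N}. i + k \<in> {0..<int N}}) :: complex) = of_int (int N - \<bar>k\<bar>)"
      by (metis of_int_of_nat_eq)
    then show ?thesis
      using N by (simp add: fejer_weight_def diff_divide_distrib)
  qed
  have "(\<lambda>N. 1 - of_int \<bar>k\<bar> / of_nat N :: complex) \<longlonglongrightarrow> 1 - 0"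
    by (intro tendsto_intros tendsto_divide_0[OF tendsto_const] tendsto_of_nat)
  then have "(\<lambda>N. 1 - of_int \<bar>k\<bar> / of_nat N :: complex) \<longlonglongrightarrow> 1"
    by simp
  moreover have "\<forall>\<^sub>F N in sequentially. 1 - of_int \<bar>k\<bar> / of_nat N = fejer_weight N k"
    by (rule eventually_sequentiallyI[of "nat \<bar>k\<bar> + 1"]) (simp only: eq)
  ultimately show ?thesis
    by (rule Lim_transform_eventually)
qed

text \<open>Discrete version of averaging the gauge action against the Fejer kernel: on frequencies
  \<open>|k| \<le> K\<close> the average over all \<open>(N + K)\<close>-th roots of unity is exact.\<close>
lemma fejer_weight_average:
  fixes N K :: nat
  assumes N: "0 < N"
  defines "M \<equiv> N + K"
  defines "c \<equiv> \<lambda>j. (cmod (\<Sum>i\<in>{0..<int N}. cis (of_int i * (2 * pi * real j / real M))))\<^sup>2 / (real M * real N)"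
  assumes k: "\<bar>k\<bar> \<le> int K"
  shows "(\<Sum>j<M. of_real (c j) * cis (of_int k * (2 * pi * real j / real M))) = fejer_weight N k"
proof -
  define I where "I = {0..<int N}"
  define \<theta> where "\<theta> j = 2 * pi * real j / real M" for j
  have M: "0 < M" using N by (simp add: M_def)
  have c: "of_real (c j) * cis (of_int k * \<theta> j)
      = (\<Sum>i\<in>I. \<Sum>l\<in>I. cis (of_int (i + k - l) * \<theta> j)) / (of_nat M * of_nat N)" for j
  proof -
    have "of_real ((cmod (\<Sum>i\<in>I. cis (of_int i * \<theta> j)))\<^sup>2)
        = (\<Sum>i\<in>I. cis (of_int i * \<theta> j)) * cnj (\<Sum>l\<in>I. cis (of_int l * \<theta> j))"
      by (rule complex_norm_square)
    also have "\<dots> = (\<Sum>i\<in>I. \<Sum>l\<in>I. cis (of_int i * \<theta> j) * cis (- (of_int l * \<theta> j)))"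
      by (simp add: sum_product cis_cnj)
    finally have E: "of_real ((cmod (\<Sum>i\<in>I. cis (of_int i * \<theta> j)))\<^sup>2)
        = (\<Sum>i\<in>I. \<Sum>l\<in>I. cis (of_int i * \<theta> j) * cis (- (of_int l * \<theta> j)))" .
    have "cis (of_int i * \<theta> j) * cis (- (of_int l * \<theta> j)) * cis (of_int k * \<theta> j)
        = cis (of_int (i + k - l) * \<theta> j)" for i l
      by (simp add: cis_mult algebra_simps)
    then have "of_real ((cmod (\<Sum>i\<in>I. cis (of_int i * \<theta> j)))\<^sup>2) * cis (of_int k * \<theta> j)
        = (\<Sum>i\<in>I. \<Sum>l\<in>I. cis (of_int (i + k - l) * \<theta> j))"
      unfolding E sum_distrib_right by (simp only:)
    then show ?thesis
      by (simp add: c_def I_def \<theta>_def)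
  qed
  have "(\<Sum>j<M. of_real (c j) * cis (of_int k * \<theta> j))
      = (\<Sum>i\<in>I. \<Sum>l\<in>I. \<Sum>j<M. cis (of_int (i + k - l) * \<theta> j)) / (of_nat M * of_nat N)"
    unfolding c sum_divide_distrib[symmetric]
    by (subst sum.swap, subst (2) sum.swap) (rule refl)
  also have "(\<Sum>i\<in>I. \<Sum>l\<in>I. \<Sum>j<M. cis (of_int (i + k - l) * \<theta> j))
      = (\<Sum>i\<in>I. \<Sum>l\<in>I. if l = i + k then of_nat M else 0)"
  proof (intro sum.cong refl)
    \<comment> \<open>Two indices in \<open>I\<close> differ by less than \<open>N\<close>. Together
      with the bound \<open>K\<close> on the frequency this is the reason for
      \<open>M = N + K\<close>: no two distinct frequencies are confused modulo
      \<open>M\<close>.\<close>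
    fix i l assume "i \<in> I" "l \<in> I"
    then have "\<bar>i + k - l\<bar> < int M"
      using k by (auto simp: I_def M_def)
    then show "(\<Sum>j<M. cis (of_int (i + k - l) * \<theta> j)) = (if l = i + k then of_nat M else 0)"
      using sum_roots_of_unity[of "i + k - l" M] by (auto simp: \<theta>_def)
  qed
  also have "\<dots> = (\<Sum>i\<in>I. if i + k \<in> I then of_nat M else 0)"
    by (simp add: I_def)
  also have "\<dots> = of_nat (card {i \<in> I. i + k \<in> I}) * of_nat M"
    by (simp add: I_def flip: sum.inter_filter)
  finally show ?thesis
    using M by (simp add: fejer_weight_def I_def \<theta>_def)
qed

lemma sum_seq_apply: "(\<Sum>j\<in>J. f j) k x = (\<Sum>j\<in>J. (f j :: 'a seq) k x)"
  by (induction J rule: infinite_finite_induct) auto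

section \<open>The gauge action and contractivity of Fejer means\<close>

context compact_dynsys
begin

interpretation full: l1_subalgebra \<sigma> L1
  by (rule L1_subalgebra)

text \<open>The dual action of the circle on the crossed product, at angle \<open>t\<close>; it is
  multiplicative because degrees add under convolution.\<close>

definition gauge_act :: "real \<Rightarrow> 'a seq \<Rightarrow> 'a seq" where
  "gauge_act t = multiplier (\<lambda>k. cis (of_int k * t))"

lemma gauge_L1: "a \<in> L1 \<Longrightarrow> gauge_act t a \<in> L1"
  unfolding gauge_act_def by (rule L1_multiplier(1)[where c = 1]) auto

lemma gauge_conv: "gauge_act t (conv \<sigma> a b) = conv \<sigma> (gauge_act t a) (gauge_act t b)"
proof (intro ext)
  fix n x
  have "cis (of_int n * t) * (a k x * b (n - k) y)
      = cis (of_int k * t) * a k x * (cis (of_int (n - k) * t) * b (n - k) y)" for k y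
  proof -
    have "cis (of_int n * t) = cis (of_int k * t) * cis (of_int (n - k) * t)"
      by (simp add: cis_mult left_diff_distrib)
    then show ?thesis by simp
  qed
  then show "gauge_act t (conv \<sigma> a b) n x = conv \<sigma> (gauge_act t a) (gauge_act t b) n x"
    by (simp only: gauge_act_def conv_apply multiplier_apply flip: infsum_cmult_right')
qed

lemma gauge_invol: "gauge_act t (invol \<sigma> a) = invol \<sigma> (gauge_act t a)"
  by (simp add: fun_eq_iff gauge_act_def invol_apply cis_cnj)

text \<open>Composing a C*-seminorm with \<open>gauge_act t\<close> gives another competitor in the
  supremum.\<close>

lemma env_gauge_le:
  assumes a: "a \<in> L1"
  shows "env \<sigma> L1 (gauge_act t a) \<le> env \<sigma> L1 a"
proof (rule env_least)
  fix p assume p: "cstar_seminorm \<sigma> L1 p"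
  have "gauge_act t (b + c) = gauge_act t b + gauge_act t c" "gauge_act t (smul z b) = smul z (gauge_act t b)" for b c z
    by (simp_all add: fun_eq_iff gauge_act_def distrib_left)
  then have "cstar_seminorm \<sigma> L1 (\<lambda>a. p (gauge_act t a))"
    using p by (simp add: cstar_seminorm_def sadd_eq_plus gauge_L1 gauge_conv gauge_invol)
  then show "p (gauge_act t a) \<le> env \<sigma> L1 a"
    by (rule full.cstar_le_env[OF _ a])
qed

lemma env_sum_le:
  assumes "finite J" "\<And>j. j \<in> J \<Longrightarrow> b j \<in> L1"
  shows "(\<Sum>j\<in>J. b j) \<in> L1 \<and> env \<sigma> L1 (\<Sum>j\<in>J. b j) \<le> (\<Sum>j\<in>J. env \<sigma> L1 (b j))"
  using assms
proof (induction J rule: finite_induct)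
  case empty
  have "smul 0 unit_seq = (0::'a seq)" by (simp add: fun_eq_iff)
  then have "(0::'a seq) \<in> L1" "env \<sigma> L1 0 \<le> 0"
    using L1_smul(1)[OF unit_L1, of 0] full.env_smul[OF unit_L1, of 0] by simp_all
  then show ?case
    by (simp only: sum.empty simp_thms)
next
  case (insert j J)
  then have J: "b j \<in> L1" "(\<Sum>j\<in>J. b j) \<in> L1" "env \<sigma> L1 (\<Sum>j\<in>J. b j) \<le> (\<Sum>j\<in>J. env \<sigma> L1 (b j))"
    by auto
  show ?case
    unfolding sum.insert[OF insert.hyps] using full.env_add[OF J(1,2)] L1_add(1)[OF J(1,2)] J(3)
    by (intro conjI) linarith+
qed

text \<open>The mean is a convex combination of gauge translates of \<open>a\<close>. Finite support
  allows a finite average in place of an integral over the circle, with a number \<open>M\<close> of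
  angles that depends on \<open>K\<close>.\<close>

lemma env_fejer_supported_le:
  assumes a: "a \<in> L1" "supported_in (int K) a" and N: "0 < N"
  shows "env \<sigma> L1 (multiplier (fejer_weight N) a) \<le> env \<sigma> L1 a"
proof -
  define M where "M = N + K"
  define \<theta> where "\<theta> j = 2 * pi * real j / real M" for j
  define c where "c j = (cmod (\<Sum>i\<in>{0..<int N}. cis (of_int i * \<theta> j)))\<^sup>2 / (real M * real N)" for j
  have avg: "(\<Sum>j<M. of_real (c j) * cis (of_int k * \<theta> j)) = fejer_weight N k" if "\<bar>k\<bar> \<le> int K" for k
    unfolding c_def \<theta>_def M_def using fejer_weight_average[OF N that] by simp
  have "complex_of_real (\<Sum>j<M. c j) = 1"
    using avg[of 0] N by (simp add: fejer_weight_0)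
  then have c1: "(\<Sum>j<M. c j) = 1"
    using of_real_eq_1_iff by blast
  have eq: "multiplier (fejer_weight N) a = (\<Sum>j<M. smul (of_real (c j)) (gauge_act (\<theta> j) a))"
  proof (intro ext)
    fix k x
    show "multiplier (fejer_weight N) a k x = (\<Sum>j<M. smul (of_real (c j)) (gauge_act (\<theta> j) a)) k x"
    proof (cases "\<bar>k\<bar> \<le> int K")
      case True
      show ?thesis
        unfolding sum_seq_apply multiplier_apply avg[OF True, symmetric]
        by (simp add: gauge_act_def sum_distrib_right mult.assoc)
    next
      case False
      then show ?thesis
        using a(2) by (simp add: sum_seq_apply gauge_act_def supported_in_def)
    qed
  qed
  have "env \<sigma> L1 (multiplier (fejer_weight N) a)
      \<le> (\<Sum>j<M. env \<sigma> L1 (smul (of_real (c j)) (gauge_act (\<theta> j) a)))"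
    unfolding eq using env_sum_le[of "{..<M}" "\<lambda>j. smul (of_real (c j)) (gauge_act (\<theta> j) a)"] a
    by (simp add: L1_smul gauge_L1)
  also have "\<dots> \<le> (\<Sum>j<M. c j * env \<sigma> L1 a)"
  proof (rule sum_mono)
    fix j
    have c0: "0 \<le> c j" by (simp add: c_def)
    have "env \<sigma> L1 (smul (of_real (c j)) (gauge_act (\<theta> j) a)) \<le> c j * env \<sigma> L1 (gauge_act (\<theta> j) a)"
      using full.env_smul[OF gauge_L1[OF a(1)], of "of_real (c j)"] c0 by simp
    also have "\<dots> \<le> c j * env \<sigma> L1 a"
      using c0 env_gauge_le[OF a(1)] by (rule mult_left_mono[rotated])
    finally show "env \<sigma> L1 (smul (of_real (c j)) (gauge_act (\<theta> j) a)) \<le> c j * env \<sigma> L1 a" .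
  qed
  also have "\<dots> = env \<sigma> L1 a"
    by (simp add: c1 flip: sum_distrib_right)
  finally show ?thesis .
qed

text \<open>The bound for supported elements does not involve \<open>K\<close>, so \<open>K\<close>
  can tend to infinity with \<open>N\<close> fixed. The tail is paid for twice: in
  \<open>trunc K a\<close> and in its own Fejer mean.\<close>

lemma env_fejer_le:
  assumes a: "a \<in> L1" and N: "0 < N"
  shows "env \<sigma> L1 (multiplier (fejer_weight N) a) \<le> env \<sigma> L1 a"
proof -
  let ?F = "multiplier (fejer_weight N)"
  have "env \<sigma> L1 (?F a) \<le> env \<sigma> L1 a + 2 * l1norm (a - trunc K a)" for K
  proof -
    note t = trunc_L1[OF a, of K]
    note d = L1_diff(1)[OF a t]
    note F = L1_multiplier[where w = "fejer_weight N" and c = 1, OF _ cmod_fejer_weight_le]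
    have "?F a = ?F (trunc K a) + ?F (a - trunc K a)"
      by (simp add: fun_eq_iff right_diff_distrib)
    then have "env \<sigma> L1 (?F a) \<le> env \<sigma> L1 (?F (trunc K a)) + env \<sigma> L1 (?F (a - trunc K a))"
      using full.env_add[OF F(1)[OF t] F(1)[OF d]] by simp
    moreover have "env \<sigma> L1 (?F (trunc K a)) \<le> env \<sigma> L1 (trunc K a)"
      by (rule env_fejer_supported_le[OF t trunc_supported N])
    moreover have "env \<sigma> L1 (trunc K a) \<le> env \<sigma> L1 a + l1norm (a - trunc K a)"
      using full.env_diff[OF a d] full.env_le_l1norm[OF d] by simp
    moreover have "env \<sigma> L1 (?F (a - trunc K a)) \<le> l1norm (a - trunc K a)"
      using full.env_le_l1norm[OF F(1)[OF d]] F(2)[OF d] by simp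
    ultimately show ?thesis by linarith
  qed
  moreover have "(\<lambda>K. env \<sigma> L1 a + 2 * l1norm (a - trunc K a)) \<longlonglongrightarrow> env \<sigma> L1 a + 2 * 0"
    by (intro tendsto_intros trunc_tendsto a)
  ultimately show ?thesis
    by (intro tendsto_lowerbound[of "\<lambda>K. env \<sigma> L1 a + 2 * l1norm (a - trunc K a)" _ sequentially]) auto
qed

section \<open>The commutant of the continuous functions\<close>

lemma comm1_iff:
  "a \<in> comm1 \<sigma> \<longleftrightarrow> a \<in> L1 \<and> (\<forall>f\<in>CX. \<forall>k x. a k x * f (spow \<sigma> (- k) x) = f x * a k x)"
  by (simp add: comm1_def fun_eq_iff conv_delta_left conv_delta_right)

lemma comm1_apply: "\<lbrakk>a \<in> comm1 \<sigma>; f \<in> CX\<rbrakk> \<Longrightarrow> a k x * f (spow \<sigma> (- k) x) = f x * a k x"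
  by (simp add: comm1_iff)

text \<open>By \<open>comm1_iff\<close> commutation is a pointwise condition, separate in each
  degree, so multipliers and pointwise limits preserve it; for products associativity is used
  instead.\<close>

lemma comm1_subalgebra: "l1_subalgebra \<sigma> (comm1 \<sigma>)"
proof (unfold_locales)
  show "comm1 \<sigma> \<subseteq> L1"
    by (auto simp: comm1_iff)
  show "unit_seq \<in> comm1 \<sigma>"
    by (simp add: comm1_iff unit_L1 delta_apply)
  fix a b :: "'a seq"
  assume a: "a \<in> comm1 \<sigma>"
  show "smul c a \<in> comm1 \<sigma>" for c
    using a by (auto simp: comm1_iff L1_smul mult.left_commute mult.assoc)
  show "multiplier w a \<in> comm1 \<sigma>" if "\<And>k. cmod (w k) \<le> 1" for w
    using a L1_multiplier(1)[OF _ that] by (auto simp: comm1_iff mult.left_commute mult.assoc)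
  show "invol \<sigma> a \<in> comm1 \<sigma>"
    unfolding comm1_iff
  proof (intro conjI ballI allI)
    show "invol \<sigma> a \<in> L1"
      using a invol_L1 by (auto simp: comm1_iff)
    fix f :: "'a \<Rightarrow> complex" and k x assume "f \<in> CX"
    \<comment> \<open>The involution conjugates and reverses degrees, so the relation for
      \<open>a\<close> is applied to the conjugate of \<open>f\<close> in degree \<open>- k\<close>,
      at a point that \<open>spow \<sigma> k\<close> sends back to \<open>x\<close>.\<close>
    then have "(\<lambda>x. cnj (f x)) \<in> CX"
      by (simp add: CX_def)
    then have "a (- k) (spow \<sigma> (- k) x) * cnj (f x)
        = cnj (f (spow \<sigma> (- k) x)) * a (- k) (spow \<sigma> (- k) x)"
      using comm1_apply[OF a, of "\<lambda>x. cnj (f x)" "- k" "spow \<sigma> (- k) x"] by simp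
    from arg_cong[OF this, of cnj]
    show "invol \<sigma> a k x * f (spow \<sigma> (- k) x) = f x * invol \<sigma> a k x"
      by (auto simp: invol_apply mult.commute)
  qed
  assume b: "b \<in> comm1 \<sigma>"
  have aL: "a \<in> L1" and bL: "b \<in> L1"
    using a b by (auto simp: comm1_iff)
  show "a + b \<in> comm1 \<sigma>"
    unfolding comm1_iff using aL bL comm1_apply[OF a] comm1_apply[OF b]
    by (auto simp only: L1_add plus_fun_apply distrib_left distrib_right)
  show "conv \<sigma> a b \<in> comm1 \<sigma>"
    unfolding comm1_def
  proof (intro CollectI conjI ballI)
    show "conv \<sigma> a b \<in> L1"
      by (rule conv_L1[OF aL bL])
    fix f :: "'a \<Rightarrow> complex" assume f: "f \<in> CX"
    then have "conv \<sigma> a (delta f) = conv \<sigma> (delta f) a" "conv \<sigma> b (delta f) = conv \<sigma> (delta f) b"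
      using a b by (auto simp: comm1_def)
    then show "conv \<sigma> (conv \<sigma> a b) (delta f) = conv \<sigma> (delta f) (conv \<sigma> a b)"
      using conv_assoc[OF aL bL] conv_assoc[OF aL delta_L1(1)[OF f] bL] conv_assoc[OF delta_L1(1)[OF f] aL bL]
        delta_L1(1)[OF f] by metis
  qed
next
  fix s and l :: "'a seq"
  assume s: "\<And>n::nat. s n \<in> comm1 \<sigma>" and l: "l \<in> L1" "(\<lambda>n. l1norm (s n - l)) \<longlonglongrightarrow> 0"
  have sL: "s n \<in> L1" for n using s by (auto simp: comm1_iff)
  have "l k x * f (spow \<sigma> (- k) x) = f x * l k x" if "f \<in> CX" for f k x
  proof (rule LIMSEQ_unique)
    show "(\<lambda>n. f x * s n k x) \<longlonglongrightarrow> f x * l k x"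
      by (intro tendsto_intros L1_limit_apply[OF sL l])
    have "(\<lambda>n. s n k x * f (spow \<sigma> (- k) x)) \<longlonglongrightarrow> l k x * f (spow \<sigma> (- k) x)"
      by (intro tendsto_intros L1_limit_apply[OF sL l])
    then show "(\<lambda>n. f x * s n k x) \<longlonglongrightarrow> l k x * f (spow \<sigma> (- k) x)"
      by (simp only: comm1_apply[OF s that])
  qed
  then show "l \<in> comm1 \<sigma>"
    using l by (simp add: comm1_iff)
qed

text \<open>\<open>s\<close> represents an element of the completion commuting with
  \<open>CX\<close>, and \<open>l k\<close> are its coefficients, obtained as uniform limits through
  \<open>supn_le_env\<close>. The family \<open>l\<close> itself need not lie in \<open>L1\<close>,
  but its Fejer mean has finite support and inherits the commutation relation degree by
  degree.\<close>

lemma comm1_dense: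
  assumes s: "\<And>n. s n \<in> L1"
    and Cauchy: "\<And>e. 0 < e \<Longrightarrow> \<exists>N. \<forall>m\<ge>N. \<forall>n\<ge>N. env \<sigma> L1 (s m - s n) < e"
    and comm: "\<And>f. f \<in> CX \<Longrightarrow>
      (\<lambda>n. env \<sigma> L1 (conv \<sigma> (s n) (delta f) - conv \<sigma> (delta f) (s n))) \<longlonglongrightarrow> 0"
    and e: "0 < e"
  shows "\<exists>b\<in>comm1 \<sigma>. \<forall>\<^sub>F n in sequentially. env \<sigma> L1 (s n - b) < e"
proof -
  have d: "s m - s n \<in> L1" for m n
    by (rule L1_diff(1)[OF s s])
  have coeff: "cmod (a k x) \<le> env \<sigma> L1 a" if "a \<in> L1" for a k x
    using L1_D(4)[OF that] supn_le_env[OF that] order_trans by blast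
  have "convergent (\<lambda>n. s n k x)" for k x
  proof (rule Cauchy_convergent, rule metric_CauchyI)
    fix r :: real assume "0 < r"
    then obtain N where "\<forall>m\<ge>N. \<forall>n\<ge>N. env \<sigma> L1 (s m - s n) < r"
      using Cauchy by blast
    then have "\<forall>m\<ge>N. \<forall>n\<ge>N. cmod ((s m - s n) k x) < r"
      using coeff[OF d] order_le_less_trans by blast
    then show "\<exists>M. \<forall>m\<ge>M. \<forall>n\<ge>M. dist (s m k x) (s n k x) < r"
      by (auto simp: dist_norm)
  qed
  then obtain l where l: "\<And>k x. (\<lambda>n. s n k x) \<longlonglongrightarrow> l k x"
    unfolding convergent_def by metis
  have unif: "\<exists>N. \<forall>n\<ge>N. \<forall>k x. cmod (s n k x - l k x) \<le> r" if "0 < r" for r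
  proof -
    obtain N where N: "\<forall>m\<ge>N. \<forall>n\<ge>N. env \<sigma> L1 (s m - s n) < r"
      using Cauchy[OF \<open>0 < r\<close>] by blast
    have "cmod (s n k x - l k x) \<le> r" if n: "N \<le> n" for n k x
    proof (rule tendsto_upperbound[of "\<lambda>m. cmod (s n k x - s m k x)" _ sequentially])
      show "(\<lambda>m. cmod (s n k x - s m k x)) \<longlonglongrightarrow> cmod (s n k x - l k x)"
        by (intro tendsto_intros l)
      have "cmod (s n k x - s m k x) \<le> r" if "N \<le> m" for m
        using N n that coeff[OF d, of n m k x] by (simp add: order_trans[OF _ less_imp_le])
      then show "\<forall>\<^sub>F m in sequentially. cmod (s n k x - s m k x) \<le> r"
        by (auto simp: eventually_sequentially)
    qed simp
    then show ?thesis by blast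
  qed
  have cont: "continuous_on UNIV (l k)" for k
  proof (rule uniform_limit_theorem)
    show "\<forall>\<^sub>F n in sequentially. continuous_on UNIV (s n k)"
      using s by (simp add: L1_D)
    show "uniform_limit UNIV (\<lambda>n. s n k) (l k) sequentially"
    proof (rule uniform_limitI)
      fix r :: real assume r: "0 < r"
      obtain N where N: "\<forall>n\<ge>N. \<forall>k x. cmod (s n k x - l k x) \<le> r / 2"
        using unif[of "r / 2"] r by auto
      have "dist (s n k x) (l k x) < r" if "N \<le> n" for n x
      proof -
        have "dist (s n k x) (l k x) \<le> r / 2" using N that by (simp add: dist_norm)
        then show ?thesis using r by linarith
      qed
      then show "\<forall>\<^sub>F n in sequentially. \<forall>x\<in>UNIV. dist (s n k x) (l k x) < r"
        unfolding eventually_sequentially by blast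
    qed
  qed auto
  have lcomm: "l k x * f (spow \<sigma> (- k) x) = f x * l k x" if f: "f \<in> CX" for f k x
  proof -
    have cL: "conv \<sigma> (s n) (delta f) - conv \<sigma> (delta f) (s n) \<in> L1" for n
      by (intro L1_diff conv_L1 s delta_L1 f)
    have "(\<lambda>n. s n k x * f (spow \<sigma> (- k) x) - f x * s n k x) \<longlonglongrightarrow> 0"
      by (rule Lim_null_comparison[OF _ comm[OF f]])
        (use coeff[OF cL, of _ k x] in \<open>auto simp: conv_delta_left conv_delta_right\<close>)
    moreover have "(\<lambda>n. s n k x * f (spow \<sigma> (- k) x) - f x * s n k x)
        \<longlonglongrightarrow> l k x * f (spow \<sigma> (- k) x) - f x * l k x"
      by (intro tendsto_intros l)
    ultimately show ?thesis
      using LIMSEQ_unique by fastforce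
  qed
  obtain n0 where n0: "\<forall>m\<ge>n0. \<forall>n\<ge>n0. env \<sigma> L1 (s m - s n) < e / 4"
    using Cauchy[of "e / 4"] e by auto
  \<comment> \<open>Convergence of Fejer means is available for elements of \<open>L1\<close>; a
    fixed approximant \<open>t\<close> determines \<open>N\<close> before \<open>n\<close> is sent
    to infinity.\<close>
  define t where "t = s n0"
  have t: "t \<in> L1" by (simp add: t_def s)
  have "(\<lambda>N. l1norm (t - multiplier (fejer_weight N) t)) \<longlonglongrightarrow> 0"
    by (rule multiplier_tendsto[OF t cmod_fejer_weight_le fejer_weight_tendsto])
  then have "\<forall>\<^sub>F N in sequentially. l1norm (t - multiplier (fejer_weight N) t) < e / 4"
    using e by (intro order_tendstoD(2)) auto
  then obtain N where N: "0 < N" "l1norm (t - multiplier (fejer_weight N) t) < e / 4"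
    unfolding eventually_sequentially by (metis le_add1 le_add2 less_add_one order_less_le_trans zero_less_one)
  define F :: "'a seq \<Rightarrow> 'a seq" where "F = multiplier (fejer_weight N)"
  note FL = L1_multiplier(1)[where w = "fejer_weight N" and c = 1, OF _ cmod_fejer_weight_le, folded F_def]
  define b where "b = F l"
  have Fl0: "F a k = (\<lambda>_. 0)" if "k \<notin> {- int N..int N}" for a k
    using that fejer_weight_eq_0[of N k] by (auto simp: F_def fun_eq_iff)
  have "b k \<in> CX" for k
    unfolding b_def F_def multiplier_def CX_def using cont by (simp add: continuous_on_mult_left)
  then have bL: "b \<in> L1"
    using L1_finite_support(1)[of "{- int N..int N}" b] Fl0 by (simp add: b_def)
  then have "b \<in> comm1 \<sigma>"
    using lcomm by (auto simp: comm1_iff b_def F_def mult.left_commute mult.assoc)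
  moreover have "\<forall>\<^sub>F n in sequentially. env \<sigma> L1 (s n - b) < e"
  proof -
    \<comment> \<open>The mean leaves at most \<open>2 * N + 1\<close> degrees, so coefficient
      errors up to \<open>r\<close> cost at most \<open>e / 4\<close> in
      \<open>l1norm\<close>.\<close>
    define r where "r = e / (4 * (2 * real N + 1))"
    have r: "0 < r" "(2 * real N + 1) * r = e / 4"
      using e by (auto simp: r_def field_simps)
    obtain n1 where n1: "\<forall>n\<ge>n1. \<forall>k x. cmod (s n k x - l k x) \<le> r"
      using unif[OF r(1)] by blast
    have "env \<sigma> L1 (s n - b) < e" if n: "max n0 n1 \<le> n" for n
    proof -
      have FsL: "F (s n) \<in> L1" and FtL: "F t \<in> L1" and stL: "s n - t \<in> L1" and tsL: "t - s n \<in> L1"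
        by (auto intro: FL s t L1_diff)
      have "env \<sigma> L1 (s n - t) < e / 4" "env \<sigma> L1 (t - s n) < e / 4"
        using n0 n by (auto simp: t_def)
      moreover have "env \<sigma> L1 (t - F t) < e / 4"
        using N(2) full.env_le_l1norm[OF L1_diff(1)[OF t FtL]] by (simp add: F_def)
      moreover have "env \<sigma> L1 (F (t - s n)) \<le> env \<sigma> L1 (t - s n)"
        unfolding F_def by (rule env_fejer_le[OF tsL N(1)])
      moreover have "F (t - s n) = F t - F (s n)"
        by (simp add: F_def fun_eq_iff right_diff_distrib)
      moreover have "env \<sigma> L1 (F (s n) - b) \<le> e / 4"
      proof -
        have "supn ((F (s n) - b) k) \<le> r" for k
        proof (rule supn_le)
          fix x
          have "cmod ((F (s n) - b) k x) = cmod (fejer_weight N k) * cmod (s n k x - l k x)"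
            by (simp add: b_def F_def flip: right_diff_distrib norm_mult)
          also have "\<dots> \<le> 1 * r"
            using n1 n r by (intro mult_mono cmod_fejer_weight_le) auto
          finally show "cmod ((F (s n) - b) k x) \<le> r" by simp
        qed
        moreover have "supported_in (int N) (F (s n) - b)"
          by (simp add: supported_in_def b_def F_def fejer_weight_eq_0)
        ultimately have "l1norm (F (s n) - b) \<le> (2 * of_int (int N) + 1) * r"
          by (intro l1norm_supported_le L1_diff FsL bL) auto
        then show ?thesis
          using full.env_le_l1norm[OF L1_diff(1)[OF FsL bL]] r(2) by simp
      qed
      \<comment> \<open>The path has four legs, each worth at most \<open>e / 4\<close>: from
        \<open>s n\<close> to \<open>t\<close>, to \<open>F t\<close>, to \<open>F (s n)\<close> by
        contractivity of \<open>F\<close>, and to \<open>b\<close>.\<close>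
      moreover have "env \<sigma> L1 (s n - b) \<le> env \<sigma> L1 (s n - t) + (env \<sigma> L1 (t - F t)
          + (env \<sigma> L1 (F t - F (s n)) + env \<sigma> L1 (F (s n) - b)))"
      proof -
        note L = L1_diff(1)[OF t FtL] L1_diff(1)[OF FtL FsL] L1_diff(1)[OF FsL bL]
        have eq: "s n - b = (s n - t) + ((t - F t) + ((F t - F (s n)) + (F (s n) - b)))"
          by simp
        show ?thesis
          unfolding eq using full.env_add[OF stL L1_add(1)[OF L(1) L1_add(1)[OF L(2,3)]]]
            full.env_add[OF L(1) L1_add(1)[OF L(2,3)]] full.env_add[OF L(2,3)] by linarith
      qed
      ultimately show ?thesis by simp
    qed
    then show ?thesis
      unfolding eventually_sequentially by blast
  qed
  ultimately show ?thesis by blast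
qed

end

text \<open>Elements of the enveloping C*-algebra are encoded as sequences in \<open>L1\<close> that
  are Cauchy for \<open>env \<sigma> L1\<close>. Commutators with each \<open>delta f\<close>
  tending to 0 express that the limit lies in the commutant, and the final clause approximates that
  limit, seen through late terms of the sequence.\<close>

theorem theorem5p1:
  fixes \<sigma> :: "'a::t2_space \<Rightarrow> 'a"
  assumes "compact (UNIV :: 'a set)"
    and "\<exists>g. homeomorphism UNIV UNIV \<sigma> g"
  shows "(\<forall>a\<in>comm1 \<sigma>. \<forall>b\<in>comm1 \<sigma>.
            sadd a b \<in> comm1 \<sigma> \<and> conv \<sigma> a b \<in> comm1 \<sigma> \<and> invol \<sigma> a \<in> comm1 \<sigma> \<and>
            (\<forall>c. smul c a \<in> comm1 \<sigma>))
       \<and> (\<forall>a\<in>comm1 \<sigma>. env \<sigma> (comm1 \<sigma>) a = env \<sigma> L1 a)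
       \<and> (\<forall>s :: nat \<Rightarrow> 'a seq.
            (\<forall>n. s n \<in> L1) \<and>
            (\<forall>e>0. \<exists>N. \<forall>m\<ge>N. \<forall>n\<ge>N. env \<sigma> L1 (ssub (s m) (s n)) < e) \<and>
            (\<forall>f\<in>CX. (\<lambda>n. env \<sigma> L1 (ssub (conv \<sigma> (s n) (delta f)) (conv \<sigma> (delta f) (s n))))
                        \<longlonglongrightarrow> 0)
            \<longrightarrow> (\<forall>e>0. \<exists>b\<in>comm1 \<sigma>. \<forall>\<^sub>F n in sequentially. env \<sigma> L1 (ssub (s n) b) < e))"
proof -
  interpret compact_dynsys \<sigma>
    using assms by unfold_locales
  interpret C: l1_subalgebra \<sigma> "comm1 \<sigma>"
    by (rule comm1_subalgebra)
  show ?thesis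
    unfolding sadd_eq_plus ssub_eq_minus
  proof (intro conjI ballI allI impI)
    fix s :: "nat \<Rightarrow> 'a seq" and e :: real
    assume s: "(\<forall>n. s n \<in> L1) \<and>
      (\<forall>e>0. \<exists>N. \<forall>m\<ge>N. \<forall>n\<ge>N. env \<sigma> L1 (s m - s n) < e) \<and>
      (\<forall>f\<in>CX. (\<lambda>n. env \<sigma> L1 (conv \<sigma> (s n) (delta f) - conv \<sigma> (delta f) (s n))) \<longlonglongrightarrow> 0)"
      and e: "0 < e"
    show "\<exists>b\<in>comm1 \<sigma>. \<forall>\<^sub>F n in sequentially. env \<sigma> L1 (s n - b) < e"
      by (rule comm1_dense) (use s e in auto)
  qed (auto intro: C.add_mem C.conv_mem C.invol_mem C.smul_mem C.env_eq_envL1)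
qed

end
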